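(* Let $n\ge 2$, $D_{\mathbf y},D_\sigma,D_{\mathbf p}\ge 0$, and let $\mathscr H=\bigcup_{f\in[\bar f]}\mathscr H^f$ be a union of finitely many ($\bar f<\infty$) component classes of expenditure shares, each chosen among the CES, Cobb–Douglas, Leontief and linear classes with parameters satisfying $\|\mathbf y\|_2\le D_{\mathbf y}$ and $\sigma\in[-1,D_\sigma]$. There is a polynomial $\mathrm{poly}$ in four variables (not depending on $K$, $\delta$, the price distribution $\tau$ or the real market) such that the following holds. Let $\mathbf p_1,\dots,\mathbf p_K$ be i.i.d. samples from $\tau$ with $\|\log \mathbf p_k\|_2\le D_{\mathbf p}$ for all $k\in[K]$, let $\mathbf g$ be the market expenditure share of the real market, and put $\mathbf g_k=\mathbf g(\mathbf p_k)$. Then for every $\delta\in(0,1)$, with probability at least $1-\delta$, every $\mathbf h\in\mathrm{conv}(\mathscr H)$ (i.e. constant wealth functions $w_t(\mathbf p)\equiv w_t$ are used for the androids) satisfies $$\mathbb E_{\mathbf p\sim\tau}\big[\ell(\mathbf h(\mathbf p),\mathbf g(\mathbf p))\big]\le L(\mathbf h)+2\sqrt2\left(\frac{\mathrm{poly}(n,D_\sigma,D_{\mathbf y},D_{\mathbf p})}{\sqrt K}+\sqrt{\frac{2\log\bar f}{K}}\right)+6\sqrt{\frac{\ln(2/\delta)}{2K}} .$$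
   Context: $\Delta_n=\{\mathbf x\in\mathbb R^n_{+}:\sum_j x_j=1\}$. Prices $\mathbf p\in\Delta_n$ are positive wherever $\log\mathbf p$ (componentwise) is used. Real market: $m$ agents with locally non-satiated concave utilities $u_i:\mathbb R^n_+\to\mathbb R$ and wealth functions $w_i\ge 0$ of the price with $\sum_i w_i(\mathbf p)=1$; agent $i$ demands $\mathbf x_i(\mathbf p)\in\arg\max\{u_i(\mathbf x):\mathbf x\in\mathbb R_+^n,\langle\mathbf p,\mathbf x\rangle\le w_i(\mathbf p)\}$ (fixed deterministic tie-breaking); aggregate demand $\mathbf d(\mathbf p)=\sum_i\mathbf x_i(\mathbf p)$; market expenditure share $\mathbf g(\mathbf p)=\mathrm{diag}(\mathbf p)\mathbf d(\mathbf p)\in\Delta_n$. Functions are assumed measurable so that the expectations make sense. Expenditure share classes (functions $\boldsymbol\gamma:\Delta_n\to\Delta_n$), with $\mathrm{softmax}(\mathbf v)=\exp(\mathbf v)/\sum_j\exp(v_j)$: CES: $\boldsymbol\gamma(\mathbf p)=\mathrm{softmax}(\mathbf y-\sigma\log\mathbf p)$; Cobb–Douglas: $\boldsymbol\gamma(\mathbf p)\equiv\mathrm{softmax}(\mathbf y)$ (the case $\sigma=0$); Leontief: $\boldsymbol\gamma(\mathbf p)=\mathrm{softmax}(\mathbf y+\log\mathbf p)$ (the case $\sigma=-1$); linear: $\boldsymbol\gamma(\mathbf p)=\mathbf e_{j^*}$ with $j^*\in\arg\max_j\{y_j-\log p_j\}$ selected by a fixed deterministic tie-breaking rule (e.g.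 smallest index). Here $\mathbf y\in\mathbb R^n$. $\mathrm{conv}(\mathscr H)$ is the set of mixtures $\mathbf h(\mathbf p)=\int_{\mathscr H}\boldsymbol\gamma(\mathbf p)\,d\omega(\boldsymbol\gamma)$ with $\omega$ a probability measure on $\mathscr H$; in particular all $\sum_{t=1}^T w_t\boldsymbol\gamma_t$ with $\boldsymbol\gamma_t\in\mathscr H$, $\mathbf w\in\Delta_T$. The loss is $\ell(\mathbf x,\mathbf x')=\|\mathbf x-\mathbf x'\|_\infty$, and the empirical risk is $L(\mathbf h)=\frac1K\sum_{k=1}^K\ell(\mathbf h(\mathbf p_k),\mathbf g_k)$. *)

theory Defs
  imports "HOL-Probability.Probability"
begin

(* The dimension n has to be quantified inside the scope of the polynomial, so vectors of R^n are
   functions on {..<n}, extensional outside, i.e. points of the space of PiM {..<n} (\<lambda>_. borel). *)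

definition orthant :: "nat \<Rightarrow> (nat \<Rightarrow> real) set" where
  "orthant n = {..<n} \<rightarrow>\<^sub>E {0..}"

definition unit_simplex :: "nat \<Rightarrow> (nat \<Rightarrow> real) set" where
  "unit_simplex n = {x \<in> orthant n. (\<Sum>j<n. x j) = 1}"

definition pos_simplex :: "nat \<Rightarrow> (nat \<Rightarrow> real) set" where
  "pos_simplex n = {p \<in> unit_simplex n. \<forall>j<n. 0 < p j}"

definition price_space :: "nat \<Rightarrow> (nat \<Rightarrow> real) measure" where
  "price_space n = restrict_space (PiM {..<n} (\<lambda>_. borel)) (pos_simplex n)"

definition log_norm :: "nat \<Rightarrow> (nat \<Rightarrow> real) \<Rightarrow> real" where
  "log_norm n p = L2_set (\<lambda>j. ln (p j)) {..<n}"

definition sup_loss :: "nat \<Rightarrow> (nat \<Rightarrow> real) \<Rightarrow> (nat \<Rightarrow> real) \<Rightarrow> real" where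
  "sup_loss n x x' = (MAX j\<in>{..<n}. \<bar>x j - x' j\<bar>)"

definition empirical_risk ::
    "nat \<Rightarrow> nat \<Rightarrow> (nat \<Rightarrow> nat \<Rightarrow> real) \<Rightarrow> (nat \<Rightarrow> nat \<Rightarrow> real) \<Rightarrow> ((nat \<Rightarrow> real) \<Rightarrow> nat \<Rightarrow> real) \<Rightarrow> real" where
  "empirical_risk n K ps gs h = (1 / real K) * (\<Sum>k<K. sup_loss n (h (ps k)) (gs k))"


definition concave_utility :: "nat \<Rightarrow> ((nat \<Rightarrow> real) \<Rightarrow> real) \<Rightarrow> bool" where
  "concave_utility n u \<longleftrightarrow> (\<forall>x\<in>orthant n. \<forall>y\<in>orthant n. \<forall>t\<in>{0..1}.
     (1 - t) * u x + t * u y \<le> u (\<lambda>j\<in>{..<n}. (1 - t) * x j + t * y j))"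

definition locally_nonsatiated :: "nat \<Rightarrow> ((nat \<Rightarrow> real) \<Rightarrow> real) \<Rightarrow> bool" where
  "locally_nonsatiated n u \<longleftrightarrow> (\<forall>x\<in>orthant n. \<forall>\<epsilon>>0. \<exists>y\<in>orthant n.
     L2_set (\<lambda>j. y j - x j) {..<n} < \<epsilon> \<and> u x < u y)"

definition budget_set :: "nat \<Rightarrow> (nat \<Rightarrow> real) \<Rightarrow> real \<Rightarrow> (nat \<Rightarrow> real) set" where
  "budget_set n p b = {x \<in> orthant n. (\<Sum>j<n. p j * x j) \<le> b}"

(* Agents are i < m, with utilities u i, wealth functions w i and demand functions x i.
   Ties between optimal bundles are broken by x i being a function of the price. *)
definition real_market ::
    "nat \<Rightarrow> nat \<Rightarrow> (nat \<Rightarrow> (nat \<Rightarrow> real) \<Rightarrow> real) \<Rightarrow> (nat \<Rightarrow> (nat \<Rightarrow> real) \<Rightarrow> real)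
      \<Rightarrow> (nat \<Rightarrow> (nat \<Rightarrow> real) \<Rightarrow> nat \<Rightarrow> real) \<Rightarrow> bool" where
  "real_market n m u w x \<longleftrightarrow>
     (\<forall>i<m. concave_utility n (u i) \<and> locally_nonsatiated n (u i)) \<and>
     (\<forall>p\<in>pos_simplex n. (\<forall>i<m. 0 \<le> w i p) \<and> (\<Sum>i<m. w i p) = 1 \<and>
        (\<forall>i<m. is_arg_max (u i) (\<lambda>z. z \<in> budget_set n p (w i p)) (x i p)))"

definition aggregate_demand ::
    "nat \<Rightarrow> nat \<Rightarrow> (nat \<Rightarrow> (nat \<Rightarrow> real) \<Rightarrow> nat \<Rightarrow> real) \<Rightarrow> (nat \<Rightarrow> real) \<Rightarrow> nat \<Rightarrow> real" where
  "aggregate_demand n m x p = (\<lambda>j\<in>{..<n}. \<Sum>i<m. x i p j)"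

definition market_share ::
    "nat \<Rightarrow> nat \<Rightarrow> (nat \<Rightarrow> (nat \<Rightarrow> real) \<Rightarrow> nat \<Rightarrow> real) \<Rightarrow> (nat \<Rightarrow> real) \<Rightarrow> nat \<Rightarrow> real" where
  "market_share n m x p = (\<lambda>j\<in>{..<n}. p j * aggregate_demand n m x p j)"


definition softmax :: "nat \<Rightarrow> (nat \<Rightarrow> real) \<Rightarrow> nat \<Rightarrow> real" where
  "softmax n v = (\<lambda>j\<in>{..<n}. exp (v j) / (\<Sum>i<n. exp (v i)))"

definition ces_share :: "nat \<Rightarrow> (nat \<Rightarrow> real) \<Rightarrow> real \<Rightarrow> (nat \<Rightarrow> real) \<Rightarrow> nat \<Rightarrow> real" where
  "ces_share n y \<sigma> = (\<lambda>p\<in>pos_simplex n. softmax n (\<lambda>j. y j - \<sigma> * ln (p j)))"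

definition cobb_douglas_share :: "nat \<Rightarrow> (nat \<Rightarrow> real) \<Rightarrow> (nat \<Rightarrow> real) \<Rightarrow> nat \<Rightarrow> real" where
  "cobb_douglas_share n y = (\<lambda>p\<in>pos_simplex n. softmax n y)"

definition leontief_share :: "nat \<Rightarrow> (nat \<Rightarrow> real) \<Rightarrow> (nat \<Rightarrow> real) \<Rightarrow> nat \<Rightarrow> real" where
  "leontief_share n y = (\<lambda>p\<in>pos_simplex n. softmax n (\<lambda>j. y j + ln (p j)))"

(* A tie-breaking rule selects an index from the set of maximisers. It sees only that set: a rule
   allowed to depend on y as well would make the class of linear shares arbitrarily complex. *)
definition tie_breaking :: "nat \<Rightarrow> (nat set \<Rightarrow> nat) \<Rightarrow> bool" where
  "tie_breaking n tb \<longleftrightarrow> (\<forall>S. S \<subseteq> {..<n} \<and> S \<noteq> {} \<longrightarrow> tb S \<in> S)"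

definition linear_share ::
    "nat \<Rightarrow> (nat set \<Rightarrow> nat) \<Rightarrow> (nat \<Rightarrow> real) \<Rightarrow> (nat \<Rightarrow> real) \<Rightarrow> nat \<Rightarrow> real" where
  "linear_share n tb y = (\<lambda>p\<in>pos_simplex n.
     let j' = tb {j. is_arg_max (\<lambda>i. y i - ln (p i)) (\<lambda>i. i < n) j}
     in (\<lambda>j\<in>{..<n}. if j = j' then 1 else 0))"

datatype share_kind = CES | Cobb_Douglas | Leontief | Linear

fun share_class ::
    "nat \<Rightarrow> (nat set \<Rightarrow> nat) \<Rightarrow> real \<Rightarrow> real \<Rightarrow> share_kind \<Rightarrow> ((nat \<Rightarrow> real) \<Rightarrow> nat \<Rightarrow> real) set" where
  "share_class n tb Dy D\<sigma> CES =
     {ces_share n y \<sigma> |y \<sigma>. L2_set y {..<n} \<le> Dy \<and> \<sigma> \<in> {-1..D\<sigma>}}"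
| "share_class n tb Dy D\<sigma> Cobb_Douglas = {cobb_douglas_share n y |y. L2_set y {..<n} \<le> Dy}"
| "share_class n tb Dy D\<sigma> Leontief = {leontief_share n y |y. L2_set y {..<n} \<le> Dy}"
| "share_class n tb Dy D\<sigma> Linear = {linear_share n tb y |y. L2_set y {..<n} \<le> Dy}"

(* The sigma-algebra carried by \<omega> is arbitrary, as long as evaluation at each price is measurable. *)
definition conv_shares ::
    "nat \<Rightarrow> ((nat \<Rightarrow> real) \<Rightarrow> nat \<Rightarrow> real) set \<Rightarrow> ((nat \<Rightarrow> real) \<Rightarrow> nat \<Rightarrow> real) set" where
  "conv_shares n H = {h. \<exists>\<omega>. prob_space \<omega> \<and> space \<omega> = H \<and>
     (\<forall>p\<in>pos_simplex n. (\<lambda>\<gamma>. \<gamma> p) \<in> \<omega> \<rightarrow>\<^sub>M PiM {..<n} (\<lambda>_. borel)) \<and>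
     (\<forall>p\<in>pos_simplex n. h p = (\<lambda>j\<in>{..<n}. \<integral>\<gamma>. \<gamma> p j \<partial>\<omega>))}"


definition polynomial4 :: "(real \<Rightarrow> real \<Rightarrow> real \<Rightarrow> real \<Rightarrow> real) \<Rightarrow> bool" where
  "polynomial4 f \<longleftrightarrow> (\<exists>N (c :: nat \<Rightarrow> nat \<Rightarrow> nat \<Rightarrow> nat \<Rightarrow> real). \<forall>x1 x2 x3 x4.
     f x1 x2 x3 x4 = (\<Sum>a\<le>N. \<Sum>b\<le>N. \<Sum>i\<le>N. \<Sum>j\<le>N. c a b i j * x1 ^ a * x2 ^ b * x3 ^ i * x4 ^ j))"

end

theory Submission
  imports Defs
begin

text \<open>
  Since the loss and the shares are only Lipschitz, not linear, all Rademacher averages are controlled through a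
  contraction principle for the sup-norm: a function that changes by at most the largest change of some features may
  be replaced by these features with independent signs. For the loss the features are the coordinates of the mixture,
  where convexity reduces mixtures to single shares. For CES shares they are the entries of y and \<sigma> log p, and for
  linear shares the indicators log p_i - log p_l < y_i - y_l. The former are linear in a bounded parameter, while the
  latter are one-dimensional threshold functions, whose Rademacher average is bounded by a reflected random walk. So
  neither chaining nor a union bound over the component classes is needed.

  Measurability of the supremum is obtained by working with uniform mixtures of shares with rational parameters, which
  approximate every mixture at finitely many prices. Replacing the expected loss by the average over a ghost sample
  makes this pointwise approximation sufficient, and symmetrization and McDiarmid's inequality conclude.
\<close>

text \<open>Signs are never random variables: \<open>rademacher_sup\<close> is an iterated mean over
  two choices, so the comparison principles are inductions on lists, and signs meet the sample only
  when pairs of its points are exchanged. Two obstacles shape the rest. Linear shares jump as the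
  parameters vary, so no grid approximates them uniformly in the price. And
  \<open>conv_shares\<close> demands measurability in the share, not in the price, so a mixture is
  accessible only through its values at finitely many prices, with an approximant that depends on
  these prices. Such an approximant says nothing about the expected loss itself, but it suffices
  under an integral over a ghost sample, provided that the supremum stands inside this integral.
  Hence the deviation bound is stated for the ghost integral of the supremum, and the passage to
  arbitrary mixtures is made for each ghost sample separately.\<close>

subsection \<open>Rademacher averages of suprema\<close>

text \<open>The accumulator \<open>g\<close> collects the signed sum of the functions processed so far.\<close>
primrec rademacher_sup :: "'t set \<Rightarrow> ('t \<Rightarrow> real) list \<Rightarrow> ('t \<Rightarrow> real) \<Rightarrow> real" where
  "rademacher_sup T [] g = (SUP t\<in>T. g t)"
| "rademacher_sup T (a # as) g =
     (rademacher_sup T as (\<lambda>t. g t + a t) + rademacher_sup T as (\<lambda>t. g t - a t)) / 2"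

section \<open>Sign averages: sums, permutations, monotonicity and contraction\<close>

lemma le_cSUP_bounded:
  fixes g :: "'t \<Rightarrow> real"
  shows "bounded (g ` T) \<Longrightarrow> t \<in> T \<Longrightarrow> g t \<le> (SUP t\<in>T. g t)"
  by (rule cSUP_upper) (auto intro: bounded_imp_bdd_above)

lemma rademacher_sup_cong:
  assumes "\<And>t. t \<in> T \<Longrightarrow> g t = g' t" "list_all2 (\<lambda>a b. \<forall>t\<in>T. a t = b t) as bs"
  shows "rademacher_sup T as g = rademacher_sup T bs g'"
  using assms(2,1)
proof (induction as bs arbitrary: g g' rule: list_all2_induct)
  case Nil
  then show ?case by (auto intro!: SUP_cong)
next
  case (Cons a as b bs)
  have "rademacher_sup T as (\<lambda>t. g t + a t) = rademacher_sup T bs (\<lambda>t. g' t + b t)"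
    "rademacher_sup T as (\<lambda>t. g t - a t) = rademacher_sup T bs (\<lambda>t. g' t - b t)"
    using Cons.prems Cons.hyps by (auto intro!: Cons.IH)
  then show ?case by simp
qed

lemma rademacher_sup_abs_le:
  fixes B c :: real
  assumes "T \<noteq> {}" "\<And>t. t \<in> T \<Longrightarrow> \<bar>g t\<bar> \<le> B" "\<And>a t. a \<in> set as \<Longrightarrow> t \<in> T \<Longrightarrow> \<bar>a t\<bar> \<le> c"
  shows "\<bar>rademacher_sup T as g\<bar> \<le> B + length as * c"
  using assms(2-)
proof (induction as arbitrary: g B)
  case Nil
  obtain t where t: "t \<in> T" using assms(1) by auto
  have b: "bdd_above (g ` T)" using Nil by (auto intro!: bdd_aboveI[of _ B] simp: abs_le_iff)
  have "(SUP t\<in>T. g t) \<le> B" using Nil assms(1) by (intro cSUP_least) (auto simp: abs_le_iff)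
  moreover have "-B \<le> g t" using Nil(1)[OF t] by linarith
  moreover have "g t \<le> (SUP t\<in>T. g t)" using t b by (rule cSUP_upper)
  ultimately show ?case by simp
next
  case (Cons a as)
  have "\<bar>rademacher_sup T as (\<lambda>t. g t + a t)\<bar> \<le> (B + c) + length as * c"
    using Cons.prems by (intro Cons.IH) (auto intro!: order_trans[OF abs_triangle_ineq] add_mono)
  moreover have "\<bar>rademacher_sup T as (\<lambda>t. g t - a t)\<bar> \<le> (B + c) + length as * c"
    using Cons.prems by (intro Cons.IH) (auto intro!: order_trans[OF abs_triangle_ineq4] add_mono)
  ultimately show ?case by (simp add: algebra_simps abs_le_iff)
qed

text \<open>Paired entries share a sign here, in contrast to \<open>rademacher_sup_append\<close>.
  This is what splits differences between a ghost sample and a sample.\<close>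

lemma rademacher_sup_add:
  assumes "T \<noteq> {}" "length as = length bs" "bounded (g ` T)" "bounded (g' ` T)"
    "\<And>a. a \<in> set as \<Longrightarrow> bounded (a ` T)" "\<And>b. b \<in> set bs \<Longrightarrow> bounded (b ` T)"
  shows "rademacher_sup T (map2 (\<lambda>a b t. a t + b t) as bs) (\<lambda>t. g t + g' t)
    \<le> rademacher_sup T as g + rademacher_sup T bs g'"
  using assms(2-)
proof (induction as bs arbitrary: g g' rule: list_induct2)
  case Nil
  then show ?case
    using assms(1) by (auto intro!: cSUP_least add_mono le_cSUP_bounded)
next
  case (Cons a as b bs)
  have e: "(\<lambda>t. g t + g' t + (a t + b t)) = (\<lambda>t. (g t + a t) + (g' t + b t))"
    "(\<lambda>t. g t + g' t - (a t + b t)) = (\<lambda>t. (g t - a t) + (g' t - b t))"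
    by auto
  let ?cs = "map2 (\<lambda>a b t. a t + b t) as bs"
  have "rademacher_sup T ?cs (\<lambda>t. (g t + a t) + (g' t + b t))
      \<le> rademacher_sup T as (\<lambda>t. g t + a t) + rademacher_sup T bs (\<lambda>t. g' t + b t)"
    "rademacher_sup T ?cs (\<lambda>t. (g t - a t) + (g' t - b t))
      \<le> rademacher_sup T as (\<lambda>t. g t - a t) + rademacher_sup T bs (\<lambda>t. g' t - b t)"
    using Cons.prems by (intro Cons.IH bounded_plus_comp bounded_minus_comp; simp)+
  then show ?case by (simp add: e field_simps)
qed

text \<open>The two lists carry independent signs; averaging over the signs of one list leaves the
  supremum belonging to the other unchanged.\<close>

lemma rademacher_sup_append:
  assumes "T \<noteq> {}" "bounded (g ` T)" "bounded (g' ` T)"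
    "\<And>a. a \<in> set as \<Longrightarrow> bounded (a ` T)" "\<And>b. b \<in> set bs \<Longrightarrow> bounded (b ` T)"
  shows "rademacher_sup T (as @ bs) (\<lambda>t. g t + g' t) \<le> rademacher_sup T as g + rademacher_sup T bs g'"
  using assms(2-)
proof (induction as arbitrary: g)
  case Nil
  then show ?case
  proof (induction bs arbitrary: g')
    case Nil
    then show ?case using assms(1) by (auto intro!: cSUP_least add_mono le_cSUP_bounded)
  next
    case (Cons b bs)
    have "rademacher_sup T bs (\<lambda>t. g t + (g' t + b t)) \<le> (SUP t\<in>T. g t) + rademacher_sup T bs (\<lambda>t. g' t + b t)"
      "rademacher_sup T bs (\<lambda>t. g t + (g' t - b t)) \<le> (SUP t\<in>T. g t) + rademacher_sup T bs (\<lambda>t. g' t - b t)"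
      using Cons.prems Cons.IH[of "\<lambda>t. g' t + b t"] Cons.IH[of "\<lambda>t. g' t - b t"]
      by (simp_all add: bounded_plus_comp bounded_minus_comp)
    moreover have "(\<lambda>t. g t + g' t + b t) = (\<lambda>t. g t + (g' t + b t))"
      "(\<lambda>t. g t + g' t - b t) = (\<lambda>t. g t + (g' t - b t))"
      by auto
    ultimately show ?case by (simp add: add_divide_distrib)
  qed
next
  case (Cons a as)
  have "rademacher_sup T (as @ bs) (\<lambda>t. (g t + a t) + g' t) \<le> rademacher_sup T as (\<lambda>t. g t + a t) + rademacher_sup T bs g'"
    "rademacher_sup T (as @ bs) (\<lambda>t. (g t - a t) + g' t) \<le> rademacher_sup T as (\<lambda>t. g t - a t) + rademacher_sup T bs g'"
    using Cons.prems by (intro Cons.IH bounded_plus_comp bounded_minus_comp; simp)+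
  moreover have "(\<lambda>t. g t + g' t + a t) = (\<lambda>t. (g t + a t) + g' t)"
    "(\<lambda>t. g t + g' t - a t) = (\<lambda>t. (g t - a t) + g' t)"
    by auto
  ultimately show ?case by (simp add: add_divide_distrib)
qed

lemma rademacher_sup_concat:
  assumes "T \<noteq> {}" "\<And>l a. l \<in> set ls \<Longrightarrow> a \<in> set (f l) \<Longrightarrow> bounded (a ` T)"
  shows "rademacher_sup T (concat (map f ls)) (\<lambda>_. 0) \<le> (\<Sum>l\<leftarrow>ls. rademacher_sup T (f l) (\<lambda>_. 0))"
  using assms(2)
proof (induction ls)
  case Nil
  then show ?case using assms(1) by simp
next
  case (Cons l ls)
  have "rademacher_sup T (f l @ concat (map f ls)) (\<lambda>t. (\<lambda>_. 0) t + (\<lambda>_. 0) t)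
      \<le> rademacher_sup T (f l) (\<lambda>_. 0) + rademacher_sup T (concat (map f ls)) (\<lambda>_. 0)"
    using Cons.prems assms(1) by (intro rademacher_sup_append) (auto simp: image_constant_conv)
  moreover have "rademacher_sup T (concat (map f ls)) (\<lambda>_. 0) \<le> (\<Sum>l\<leftarrow>ls. rademacher_sup T (f l) (\<lambda>_. 0))"
    using Cons by auto
  ultimately show ?case by simp
qed

lemma rademacher_sup_move: "rademacher_sup T (as @ a # bs) g = rademacher_sup T (a # as @ bs) g"
proof (induction as arbitrary: g)
  case (Cons b as)
  have "(\<lambda>t. g t + b t + a t) = (\<lambda>t. g t + a t + b t)" "(\<lambda>t. g t + b t - a t) = (\<lambda>t. g t - a t + b t)"
    "(\<lambda>t. g t - b t + a t) = (\<lambda>t. g t + a t - b t)" "(\<lambda>t. g t - b t - a t) = (\<lambda>t. g t - a t - b t)"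
    by auto
  then show ?case by (simp add: Cons.IH add_divide_distrib)
qed simp

text \<open>A mean over independent signs does not depend on their order. This permits sorting
  thresholds and regrouping features below.\<close>

lemma rademacher_sup_mset:
  "mset as = mset bs \<Longrightarrow> rademacher_sup T as g = rademacher_sup T bs g"
proof (induction as arbitrary: bs g)
  case (Cons a as)
  have "a \<in> set bs" using Cons.prems by (metis list.set_intros(1) set_mset_mset)
  then obtain us vs where bs: "bs = us @ a # vs" by (meson split_list)
  then have "mset as = mset (us @ vs)" using Cons.prems by simp
  then have "rademacher_sup T (a # as) g = rademacher_sup T (a # us @ vs) g"
    using Cons.IH[of "us @ vs"] by simp
  then show ?case unfolding bs rademacher_sup_move .
qed simp

lemma rademacher_sup_uminus: "rademacher_sup T (map (\<lambda>k t. - a k t) ks) g = rademacher_sup T (map a ks) g"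
  by (induction ks arbitrary: g) simp_all

text \<open>Jensen's inequality: the supremum is convex in the accumulator, and \<open>g\<close> is
  the midpoint of \<open>g + a\<close> and \<open>g - a\<close>, so a further sign can only increase
  the mean.\<close>

lemma rademacher_sup_Cons_ge:
  assumes "T \<noteq> {}" "bounded (g ` T)" "bounded (a ` T)" "\<And>b. b \<in> set as \<Longrightarrow> bounded (b ` T)"
  shows "rademacher_sup T as g \<le> rademacher_sup T (a # as) g"
  using assms(2,4)
proof (induction as arbitrary: g)
  case Nil
  have "2 * g t \<le> (SUP t\<in>T. g t + a t) + (SUP t\<in>T. g t - a t)" if "t \<in> T" for t
  proof -
    have "g t + a t \<le> (SUP t\<in>T. g t + a t)" "g t - a t \<le> (SUP t\<in>T. g t - a t)"
      using that Nil assms(3)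
      by (auto intro!: le_cSUP_bounded[where g="\<lambda>t. g t + a t"] le_cSUP_bounded[where g="\<lambda>t. g t - a t"]
          bounded_plus_comp bounded_minus_comp)
    then show ?thesis by simp
  qed
  then have "(SUP t\<in>T. g t) \<le> ((SUP t\<in>T. g t + a t) + (SUP t\<in>T. g t - a t)) / 2"
    by (intro cSUP_least assms(1)) (simp add: field_simps)
  then show ?case by simp
next
  case (Cons b as)
  have "rademacher_sup T as (\<lambda>t. g t + b t) \<le> rademacher_sup T (a # as) (\<lambda>t. g t + b t)"
    "rademacher_sup T as (\<lambda>t. g t - b t) \<le> rademacher_sup T (a # as) (\<lambda>t. g t - b t)"
    using Cons.prems by (intro Cons.IH bounded_plus_comp bounded_minus_comp; simp)+
  then have "rademacher_sup T (b # as) g \<le> rademacher_sup T (b # a # as) g"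
    unfolding rademacher_sup.simps(2)[of T b] by (intro divide_right_mono add_mono) auto
  also have "\<dots> = rademacher_sup T (a # b # as) g"
    by (rule rademacher_sup_mset) simp
  finally show ?case .
qed

lemma rademacher_sup_append_ge:
  assumes "T \<noteq> {}" "bounded (g ` T)" "\<And>b. b \<in> set (bs @ as) \<Longrightarrow> bounded (b ` T)"
  shows "rademacher_sup T as g \<le> rademacher_sup T (bs @ as) g"
  using assms(3)
proof (induction bs)
  case (Cons b bs)
  then have "rademacher_sup T as g \<le> rademacher_sup T (bs @ as) g" by simp
  also have "\<dots> \<le> rademacher_sup T (b # bs @ as) g"
    using assms(1,2) Cons.prems by (intro rademacher_sup_Cons_ge) auto
  finally show ?case by simp
qed simp

text \<open>Twice the left side is the supremum of \<open>g t + g t' + \<phi> t - \<phi> t'\<close>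
  over pairs. For a fixed pair a single feature dominates the increment of \<open>\<phi>\<close>.
  Which one depends on the pair, so all of \<open>vs\<close> is kept on the right, which is possible
  since further signs only increase the mean.\<close>

lemma rademacher_contraction_single:
  assumes T: "T \<noteq> {}" "bounded (g ` T)" and vs: "\<And>b. b \<in> set vs \<Longrightarrow> bounded (b ` T)"
    and lip: "\<And>t t'. t \<in> T \<Longrightarrow> t' \<in> T \<Longrightarrow> \<exists>v\<in>set vs. \<bar>\<phi> t - \<phi> t'\<bar> \<le> \<bar>v t - v t'\<bar>"
  shows "rademacher_sup T [\<phi>] g \<le> rademacher_sup T vs g"
proof -
  have *: "(g t + \<phi> t) + (g t' - \<phi> t') \<le> 2 * rademacher_sup T vs g" if t: "t \<in> T" "t' \<in> T" for t t'
  proof -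
    obtain v where v: "v \<in> set vs" "\<bar>\<phi> t - \<phi> t'\<bar> \<le> \<bar>v t - v t'\<bar>" using lip t by blast
    have bv: "bounded ((\<lambda>t. g t + v t) ` T)" "bounded ((\<lambda>t. g t - v t) ` T)"
      using T vs v(1) by (auto intro!: bounded_plus_comp bounded_minus_comp)
    have 1: "s \<in> T \<Longrightarrow> g s + v s \<le> (SUP t\<in>T. g t + v t)" "s \<in> T \<Longrightarrow> g s - v s \<le> (SUP t\<in>T. g t - v t)" for s
      using le_cSUP_bounded[OF bv(1)] le_cSUP_bounded[OF bv(2)] by auto
    have "(g t + \<phi> t) + (g t' - \<phi> t') \<le> g t + g t' + \<bar>v t - v t'\<bar>" using v(2) by auto
    \<comment> \<open>\<open>g t + g t'\<close> is symmetric, so the sign of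
      \<open>v t - v t'\<close> decides which of the two points receives the plus.\<close>
    also have "\<dots> \<le> (SUP t\<in>T. g t + v t) + (SUP t\<in>T. g t - v t)"
      using 1[OF t(1)] 1[OF t(2)] by (auto simp: abs_if)
    also have "\<dots> = 2 * rademacher_sup T [v] g" by simp
    also obtain us ws where uw: "vs = us @ v # ws" using v(1) by (meson split_list)
    have "rademacher_sup T [v] g \<le> rademacher_sup T ((us @ ws) @ [v]) g"
      using T vs uw by (intro rademacher_sup_append_ge) auto
    also have "\<dots> = rademacher_sup T vs g"
      by (rule rademacher_sup_mset) (simp add: uw)
    finally show ?thesis by simp
  qed
  have "g t + \<phi> t \<le> 2 * rademacher_sup T vs g - (SUP t\<in>T. g t - \<phi> t)" if "t \<in> T" for t
  proof -
    have "(SUP t\<in>T. g t - \<phi> t) \<le> 2 * rademacher_sup T vs g - (g t + \<phi> t)"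
      using *[OF that] by (intro cSUP_least T) (simp add: algebra_simps)
    then show ?thesis by simp
  qed
  then have "(SUP t\<in>T. g t + \<phi> t) \<le> 2 * rademacher_sup T vs g - (SUP t\<in>T. g t - \<phi> t)"
    by (intro cSUP_least T)
  then show ?thesis by simp
qed

text \<open>The first hypothesis ranges over all bounded accumulators because the entries of
  \<open>as\<close> are absorbed into \<open>g\<close> before the tails are compared.\<close>

lemma rademacher_sup_append_mono:
  assumes "\<And>g. bounded (g ` T) \<Longrightarrow> rademacher_sup T bs g \<le> rademacher_sup T cs g"
    "bounded (g ` T)" "\<And>a. a \<in> set as \<Longrightarrow> bounded (a ` T)"
  shows "rademacher_sup T (as @ bs) g \<le> rademacher_sup T (as @ cs) g"
  using assms(2,3)
proof (induction as arbitrary: g)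
  case (Cons a as)
  have "rademacher_sup T (as @ bs) (\<lambda>t. g t + a t) \<le> rademacher_sup T (as @ cs) (\<lambda>t. g t + a t)"
    "rademacher_sup T (as @ bs) (\<lambda>t. g t - a t) \<le> rademacher_sup T (as @ cs) (\<lambda>t. g t - a t)"
    using Cons.prems by (intro Cons.IH bounded_plus_comp bounded_minus_comp; simp)+
  then show ?case by simp
qed (use assms(1) in simp)

lemma rademacher_contraction:
  assumes T: "T \<noteq> {}" "bounded (g ` T)"
    and bd: "\<And>k b. k \<in> set ks \<Longrightarrow> b \<in> set (vs k) \<Longrightarrow> bounded (b ` T)"
      "\<And>k. k \<in> set ks \<Longrightarrow> bounded (\<phi> k ` T)"
    and lip: "\<And>k t t'. k \<in> set ks \<Longrightarrow> t \<in> T \<Longrightarrow> t' \<in> T \<Longrightarrow> \<exists>v\<in>set (vs k). \<bar>\<phi> k t - \<phi> k t'\<bar> \<le> \<bar>v t - v t'\<bar>"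
  shows "rademacher_sup T (map \<phi> ks) g \<le> rademacher_sup T (concat (map vs ks)) g"
  using assms(2-)
proof (induction ks arbitrary: g)
  case (Cons k ks)
  let ?c = "concat (map vs ks)"
  have "rademacher_sup T (map \<phi> ks) (\<lambda>t. g t + \<phi> k t) \<le> rademacher_sup T ?c (\<lambda>t. g t + \<phi> k t)"
    "rademacher_sup T (map \<phi> ks) (\<lambda>t. g t - \<phi> k t) \<le> rademacher_sup T ?c (\<lambda>t. g t - \<phi> k t)"
    by (intro Cons.IH bounded_plus_comp bounded_minus_comp Cons.prems; simp add: Cons.prems(2))+
  then have "rademacher_sup T (map \<phi> (k # ks)) g \<le> rademacher_sup T (\<phi> k # ?c) g" by simp
  \<comment> \<open>Moving \<open>\<phi> k\<close> to the end makes the converted features a common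
    prefix, so only a one-element tail has to be contracted.\<close>
  also have "\<dots> = rademacher_sup T (?c @ [\<phi> k]) g" by (rule rademacher_sup_mset) simp
  also have "\<dots> \<le> rademacher_sup T (?c @ vs k) g"
    using Cons.prems
    by (intro rademacher_sup_append_mono rademacher_contraction_single T(1)) auto
  also have "\<dots> = rademacher_sup T (vs k @ ?c) g" by (rule rademacher_sup_mset) simp
  finally show ?case by simp
qed simp

text \<open>Contraction lists the features point by point. Grouping them feature by feature yields,
  for each feature, one class of scalar functions on all points, which the explicit bounds can
  treat.\<close>

lemma rademacher_sup_concat_transpose:
  "rademacher_sup T (concat (map (\<lambda>k. map (f k) ls) ks)) g
    = rademacher_sup T (concat (map (\<lambda>l. map (\<lambda>k. f k l) ks) ls)) g"
proof (rule rademacher_sup_mset)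
  have *: "mset (concat (map (\<lambda>l. f k l # h l) ls)) = mset (map (f k) ls) + mset (concat (map h ls))" for k h
    by (induction ls) auto
  show "mset (concat (map (\<lambda>k. map (f k) ls) ks)) = mset (concat (map (\<lambda>l. map (\<lambda>k. f k l) ks) ls))"
  proof (induction ks)
    case Nil
    show ?case by (induction ls) auto
  next
    case (Cons k ks)
    then show ?case by (simp add: *)
  qed
qed

section \<open>Uniform mixtures as averages over lists\<close>

definition list_avg :: "('t \<Rightarrow> real) \<Rightarrow> 't list \<Rightarrow> real" where
  "list_avg a xs = (\<Sum>x\<leftarrow>xs. a x) / length xs"

lemma list_avg_add: "list_avg (\<lambda>t. a t + b t) xs = list_avg a xs + list_avg b xs"
  by (simp add: list_avg_def sum_list_addf add_divide_distrib)

lemma list_avg_diff: "list_avg (\<lambda>t. a t - b t) xs = list_avg a xs - list_avg b xs"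
  by (simp add: list_avg_def sum_list_subtractf diff_divide_distrib)

lemma list_avg_le:
  assumes "xs \<noteq> []" "\<And>x. x \<in> set xs \<Longrightarrow> a x \<le> B"
  shows "list_avg a xs \<le> B"
proof -
  have "(\<Sum>x\<leftarrow>xs. a x) \<le> (\<Sum>x\<leftarrow>xs. B)" using assms(2) by (intro sum_list_mono) auto
  then show ?thesis using assms(1) by (simp add: list_avg_def divide_le_eq sum_list_triv mult.commute)
qed

lemma list_avg_ge:
  assumes "xs \<noteq> []" "\<And>x. x \<in> set xs \<Longrightarrow> B \<le> a x"
  shows "B \<le> list_avg a xs"
  using list_avg_le[of xs "\<lambda>x. - a x" "- B"] assms list_avg_diff[of "\<lambda>_. 0" a xs]
  by (simp add: list_avg_def)

text \<open>Signed sums of averages are averages of signed sums, and an average never exceeds the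
  supremum. Lists may repeat entries and so represent all mixtures with rational weights, while a
  countable \<open>T\<close> gives only countably many lists.\<close>

lemma rademacher_sup_mixture:
  assumes "T \<noteq> {}" "bounded (g ` T)" "\<And>a. a \<in> set as \<Longrightarrow> bounded (a ` T)"
  shows "rademacher_sup {xs. xs \<noteq> [] \<and> set xs \<subseteq> T} (map list_avg as) (list_avg g) \<le> rademacher_sup T as g"
  using assms(2,3)
proof (induction as arbitrary: g)
  case Nil
  obtain t where "t \<in> T" using assms(1) by auto
  then have ne: "{xs. xs \<noteq> [] \<and> set xs \<subseteq> T} \<noteq> {}" by (intro ex_in_conv[THEN iffD1] exI[of _ "[t]"]) auto
  show ?case
    using Nil by (auto intro!: cSUP_least[OF ne] list_avg_le le_cSUP_bounded)
next
  case (Cons a as)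
  have "rademacher_sup {xs. xs \<noteq> [] \<and> set xs \<subseteq> T} (map list_avg as) (list_avg (\<lambda>t. g t + a t)) \<le> rademacher_sup T as (\<lambda>t. g t + a t)"
    "rademacher_sup {xs. xs \<noteq> [] \<and> set xs \<subseteq> T} (map list_avg as) (list_avg (\<lambda>t. g t - a t)) \<le> rademacher_sup T as (\<lambda>t. g t - a t)"
    using Cons.prems by (intro Cons.IH bounded_plus_comp bounded_minus_comp; simp)+
  then show ?case by (simp add: list_avg_add[abs_def] list_avg_diff[abs_def])
qed

section \<open>Explicit bounds for linear classes and for threshold classes\<close>

lemma sqrt_midpoint:
  fixes x y :: real
  shows "0 \<le> x \<Longrightarrow> 0 \<le> y \<Longrightarrow> (sqrt x + sqrt y) / 2 \<le> sqrt ((x + y) / 2)"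
proof (rule real_le_rsqrt)
  assume "0 \<le> x" "0 \<le> y"
  then have "(sqrt x + sqrt y)\<^sup>2 + (sqrt x - sqrt y)\<^sup>2 = 2 * (x + y)"
    by (simp add: power2_sum power2_diff)
  moreover have "0 \<le> (sqrt x - sqrt y)\<^sup>2" by simp
  ultimately have "(sqrt x + sqrt y)\<^sup>2 \<le> 2 * (x + y)" by linarith
  moreover have "((sqrt x + sqrt y) / 2)\<^sup>2 = (sqrt x + sqrt y)\<^sup>2 / 4"
    by (simp only: power_divide) simp
  ultimately show "((sqrt x + sqrt y) / 2)\<^sup>2 \<le> (x + y) / 2" by linarith
qed

text \<open>The second-moment bound of a random sum, unrolled: the two signs replace
  \<open>s\<close> by \<open>s + x\<close> and \<open>s - x\<close>, whose squares average to
  \<open>s\<^sup>2 + x\<^sup>2\<close>, and concavity of the square root passes this on. The offset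
  \<open>s\<close> makes the induction close.\<close>

lemma rademacher_sup_linear:
  assumes "T \<noteq> {}" "\<And>t. t \<in> T \<Longrightarrow> \<bar>c t\<bar> \<le> B"
  shows "rademacher_sup T (map (\<lambda>x t. c t * x) xs) (\<lambda>t. c t * s) \<le> B * sqrt (s\<^sup>2 + (\<Sum>x\<leftarrow>xs. x\<^sup>2))"
proof (induction xs arbitrary: s)
  case Nil
  have "c t * s \<le> B * \<bar>s\<bar>" if "t \<in> T" for t
  proof -
    have "c t * s \<le> \<bar>c t\<bar> * \<bar>s\<bar>" by (simp add: abs_mult[symmetric])
    also have "\<dots> \<le> B * \<bar>s\<bar>" using assms(2)[OF that] by (intro mult_right_mono) auto
    finally show ?thesis .
  qed
  then show ?case using assms(1) by (auto intro!: cSUP_least)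
next
  case (Cons x xs)
  let ?n = "\<Sum>x\<leftarrow>xs. x\<^sup>2"
  have n: "0 \<le> ?n" by (intro sum_list_nonneg) auto
  have B: "0 \<le> B" using assms by (meson abs_ge_zero ex_in_conv order_trans)
  have "rademacher_sup T (map (\<lambda>x t. c t * x) (x # xs)) (\<lambda>t. c t * s)
      = (rademacher_sup T (map (\<lambda>x t. c t * x) xs) (\<lambda>t. c t * (s + x)) + rademacher_sup T (map (\<lambda>x t. c t * x) xs) (\<lambda>t. c t * (s - x))) / 2"
    by (simp add: algebra_simps)
  also have "\<dots> \<le> B * ((sqrt ((s + x)\<^sup>2 + ?n) + sqrt ((s - x)\<^sup>2 + ?n)) / 2)"
    using Cons.IH[of "s + x"] Cons.IH[of "s - x"] by (simp add: algebra_simps)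
  also have "\<dots> \<le> B * sqrt ((((s + x)\<^sup>2 + ?n) + ((s - x)\<^sup>2 + ?n)) / 2)"
    using n B by (intro mult_left_mono sqrt_midpoint) auto
  also have "(((s + x)\<^sup>2 + ?n) + ((s - x)\<^sup>2 + ?n)) / 2 = s\<^sup>2 + (\<Sum>x\<leftarrow>x # xs. x\<^sup>2)"
    by (simp add: power2_eq_square algebra_simps)
  finally show ?case .
qed

(* z dominates the supremum of the partial sums processed so far; as the points are processed in
   decreasing order it evolves like a random walk reflected at 0. *)
lemma rademacher_sup_threshold_sorted:
  fixes c :: "'t \<Rightarrow> real"
  assumes "T \<noteq> {}" "sorted_wrt (\<ge>) xs" "0 \<le> z" "\<And>t. t \<in> T \<Longrightarrow> g t \<le> z"
    "\<And>t x. t \<in> T \<Longrightarrow> x \<in> set xs \<Longrightarrow> c t \<le> x \<Longrightarrow> g t \<le> 0"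
  shows "rademacher_sup T (map (\<lambda>x t. of_bool (x < c t)) xs) g \<le> sqrt (z\<^sup>2 + length xs)"
  using assms(2-)
proof (induction xs arbitrary: g z)
  case Nil
  then show ?case using assms(1) by (auto intro!: cSUP_least)
next
  case (Cons x xs)
  let ?R = "\<lambda>g. rademacher_sup T (map (\<lambda>x t. of_bool (x < c t)) xs) g"
  let ?n = "real (length xs)"
  have "?R (\<lambda>t. g t + of_bool (x < c t)) \<le> sqrt ((z + 1)\<^sup>2 + ?n)"
  proof (rule Cons.IH)
    show "g t + of_bool (x < c t) \<le> z + 1" if "t \<in> T" for t using Cons.prems(3)[OF that] by auto
    \<comment> \<open>If \<open>c t\<close> is at most a remaining point, it is at most
      \<open>x\<close> too, so the indicator vanishes and \<open>g t \<le> 0\<close>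
      survives.\<close>
    show "g t + of_bool (x < c t) \<le> 0" if "t \<in> T" "x' \<in> set xs" "c t \<le> x'" for t x'
    proof -
      have "c t \<le> x" using Cons.prems(1) that(2,3) by (simp, meson order_trans)
      then show ?thesis using Cons.prems(4)[OF that(1), of x] by simp
    qed
  qed (use Cons.prems in auto)
  \<comment> \<open>With a minus sign, the indices with \<open>x < c t\<close> drop by one, and the
    others satisfy \<open>g t \<le> 0\<close> already; hence the reflection.\<close>
  moreover have "?R (\<lambda>t. g t - of_bool (x < c t)) \<le> sqrt ((max 0 (z - 1))\<^sup>2 + ?n)"
  proof (rule Cons.IH)
    show "g t - of_bool (x < c t) \<le> max 0 (z - 1)" if "t \<in> T" for t
      using Cons.prems(3)[OF that] Cons.prems(4)[OF that, of x] by (cases "x < c t") auto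
    show "g t - of_bool (x < c t) \<le> 0" if "t \<in> T" "x' \<in> set xs" "c t \<le> x'" for t x'
    proof -
      have "c t \<le> x" using Cons.prems(1) that(2,3) by (simp, meson order_trans)
      then show ?thesis using Cons.prems(4)[OF that(1), of x] by simp
    qed
  qed (use Cons.prems in auto)
  ultimately have "rademacher_sup T (map (\<lambda>x t. of_bool (x < c t)) (x # xs)) g
      \<le> (sqrt ((z + 1)\<^sup>2 + ?n) + sqrt ((max 0 (z - 1))\<^sup>2 + ?n)) / 2"
    by simp
  also have "\<dots> \<le> sqrt ((((z + 1)\<^sup>2 + ?n) + ((max 0 (z - 1))\<^sup>2 + ?n)) / 2)"
    by (intro sqrt_midpoint) auto
  also have "\<dots> \<le> sqrt (z\<^sup>2 + length (x # xs))"
  proof (intro real_sqrt_le_mono)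
    \<comment> \<open>Reflection does not increase the square, so the two squares average to at most
      \<open>z\<^sup>2 + 1\<close>, as for the free walk.\<close>
    have "(max 0 (z - 1))\<^sup>2 \<le> (z - 1)\<^sup>2" by (auto simp: max_def)
    then show "(((z + 1)\<^sup>2 + ?n) + ((max 0 (z - 1))\<^sup>2 + ?n)) / 2 \<le> z\<^sup>2 + real (length (x # xs))"
      by (simp add: power2_eq_square algebra_simps)
  qed
  finally show ?case .
qed

lemma rademacher_sup_threshold:
  fixes c :: "'t \<Rightarrow> real"
  assumes "T \<noteq> {}"
  shows "rademacher_sup T (map (\<lambda>x t. of_bool (x < c t)) xs) (\<lambda>_. 0) \<le> sqrt (length xs)"
proof -
  let ?ys = "rev (sort xs)"
  have "rademacher_sup T (map (\<lambda>x t. of_bool (x < c t)) xs) (\<lambda>_. 0)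
      = rademacher_sup T (map (\<lambda>x t. of_bool (x < c t)) ?ys) (\<lambda>_. 0)"
    by (rule rademacher_sup_mset) simp
  also have "\<dots> \<le> sqrt (0\<^sup>2 + real (length ?ys))"
    using assms by (intro rademacher_sup_threshold_sorted) (auto simp: sorted_wrt_rev)
  finally show ?thesis by simp
qed

subsection \<open>Concentration and symmetrization\<close>

lemma rademacher_sup_measurable:
  fixes B c :: real
  assumes T: "countable T" "T \<noteq> {}"
    and g: "\<And>t. t \<in> T \<Longrightarrow> (\<lambda>\<omega>. g t \<omega>) \<in> borel_measurable M"
      "\<And>t \<omega>. t \<in> T \<Longrightarrow> \<omega> \<in> space M \<Longrightarrow> \<bar>g t \<omega>\<bar> \<le> B"
    and a: "\<And>k t. k \<in> set ks \<Longrightarrow> t \<in> T \<Longrightarrow> (\<lambda>\<omega>. a k t \<omega>) \<in> borel_measurable M"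
      "\<And>k t \<omega>. k \<in> set ks \<Longrightarrow> t \<in> T \<Longrightarrow> \<omega> \<in> space M \<Longrightarrow> \<bar>a k t \<omega>\<bar> \<le> c"
  shows "(\<lambda>\<omega>. rademacher_sup T (map (\<lambda>k t. a k t \<omega>) ks) (\<lambda>t. g t \<omega>)) \<in> borel_measurable M"
  using g a
proof (induction ks arbitrary: g B)
  case Nil
  have "bdd_above ((\<lambda>t. g t \<omega>) ` T)" if "\<omega> \<in> space M" for \<omega>
    using Nil(2)[OF _ that] by (intro bdd_aboveI[of _ B]) (auto dest: abs_le_D1)
  then show ?case using Nil T by (auto intro!: borel_measurable_cSUP)
next
  case (Cons k ks)
  have "(\<lambda>\<omega>. rademacher_sup T (map (\<lambda>k t. a k t \<omega>) ks) (\<lambda>t. g t \<omega> + a k t \<omega>)) \<in> borel_measurable M"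
    using Cons.prems
    by (intro Cons.IH[where B="B + c"] borel_measurable_add)
      (auto intro!: order_trans[OF abs_triangle_ineq] add_mono)
  moreover have "(\<lambda>\<omega>. rademacher_sup T (map (\<lambda>k t. a k t \<omega>) ks) (\<lambda>t. g t \<omega> - a k t \<omega>)) \<in> borel_measurable M"
    using Cons.prems
    by (intro Cons.IH[where B="B + c"] borel_measurable_diff)
      (auto intro!: order_trans[OF abs_triangle_ineq4] add_mono)
  ultimately show ?case by simp
qed

section \<open>Exponential moments and bounded differences\<close>

lemma (in prob_space) Hoeffding_mgf:
  fixes f :: "'a \<Rightarrow> real" and c :: real
  assumes [measurable]: "f \<in> borel_measurable M"
    and range: "\<And>x y. x \<in> space M \<Longrightarrow> y \<in> space M \<Longrightarrow> f x - f y \<le> c"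
  shows "integrable M (\<lambda>x. exp (f x))" "expectation (\<lambda>x. exp (f x)) \<le> exp (expectation f + c\<^sup>2 / 8)"
proof -
  obtain x0 where x0: "x0 \<in> space M" using not_empty by auto
  \<comment> \<open>Only the oscillation of \<open>f\<close> is bounded, so the interval for
    Hoeffding's lemma starts at the infimum. In the product argument its position varies with the
    other coordinates.\<close>
  define a where "a = (INF x\<in>space M. f x)"
  have bdd: "bdd_below (f ` space M)"
    using range[OF x0] by (intro bdd_belowI2[of _ "f x0 - c"]) (auto simp: algebra_simps)
  have "a \<le> f x" if "x \<in> space M" for x
    unfolding a_def using bdd that by (rule cINF_lower)
  moreover have "f x \<le> a + c" if "x \<in> space M" for x
  proof -
    have "f x - c \<le> a"
      unfolding a_def using range[OF that] not_empty by (intro cINF_greatest) (auto simp: algebra_simps)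
    then show ?thesis by simp
  qed
  ultimately have ab: "f x \<in> {a..a + c}" if "x \<in> space M" for x
    using that by simp
  interpret interval_bounded_random_variable M f a "a + c"
    by unfold_locales (auto simp: ab[simplified])
  have "(\<integral>\<^sup>+x. ennreal (exp (1 * (f x - expectation f))) \<partial>M) \<le> ennreal (exp (1\<^sup>2 * (a + c - a)\<^sup>2 / 8))"
    by (rule Hoeffdings_lemma_nn_integral) simp
  then have *: "(\<integral>\<^sup>+x. ennreal (exp (f x - expectation f)) \<partial>M) \<le> ennreal (exp (c\<^sup>2 / 8))"
    by simp
  have int: "integrable M (\<lambda>x. exp (f x - expectation f))"
    using * by (intro integrableI_nonneg) (auto simp: le_less_trans)
  have e: "exp (f x) = exp (expectation f) * exp (f x - expectation f)" for x
    by (simp add: exp_diff)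
  show "integrable M (\<lambda>x. exp (f x))"
    unfolding e using int by (rule integrable_mult_right)
  have "expectation (\<lambda>x. exp (f x - expectation f)) \<le> exp (c\<^sup>2 / 8)"
    using * int by (subst (asm) nn_integral_eq_integral) auto
  then have "exp (expectation f) * expectation (\<lambda>x. exp (f x - expectation f)) \<le> exp (expectation f) * exp (c\<^sup>2 / 8)"
    by (intro mult_left_mono) auto
  then show "expectation (\<lambda>x. exp (f x)) \<le> exp (expectation f + c\<^sup>2 / 8)"
    by (simp only: e integral_mult_right_zero exp_add)
qed

text \<open>Induction over coordinates in place of a martingale: with the others fixed, integrating
  out \<open>i\<close> costs a factor \<open>exp (c\<^sup>2 / 8)\<close> by Hoeffding's lemma, and
  the mean \<open>F\<close> over coordinate \<open>i\<close> again has differences at most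
  \<open>c\<close>.\<close>

lemma bounded_differences_mgf:
  fixes f :: "('i \<Rightarrow> 'a) \<Rightarrow> real" and B c :: real
  assumes "prob_space M" "finite I"
    and "f \<in> borel_measurable (PiM I (\<lambda>_. M))" "\<And>x. x \<in> space (PiM I (\<lambda>_. M)) \<Longrightarrow> \<bar>f x\<bar> \<le> B"
    and "\<And>x i y. x \<in> space (PiM I (\<lambda>_. M)) \<Longrightarrow> i \<in> I \<Longrightarrow> y \<in> space M \<Longrightarrow> f (x(i := y)) - f x \<le> c"
  shows "(\<integral>x. exp (f x) \<partial>PiM I (\<lambda>_. M)) \<le> exp ((\<integral>x. f x \<partial>PiM I (\<lambda>_. M)) + card I * c\<^sup>2 / 8)"
  using assms(2-)
proof (induction I arbitrary: f)
  case empty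
  then show ?case by (simp add: PiM_empty lebesgue_integral_count_space_finite)
next
  case (insert i I)
  interpret M: prob_space M by fact
  interpret product_sigma_finite "\<lambda>_. M" by unfold_locales
  interpret I: prob_space "PiM I (\<lambda>_. M)" by (intro prob_space_PiM assms(1))
  interpret iI: prob_space "PiM (insert i I) (\<lambda>_. M)" by (intro prob_space_PiM assms(1))
  note [measurable] = insert.prems(1)
  have sp: "x(i := y) \<in> space (PiM (insert i I) (\<lambda>_. M))" if "x \<in> space (PiM I (\<lambda>_. M))" "y \<in> space M" for x y
    using that by (auto simp: space_PiM PiE_def extensional_def)
  have meas2: "(\<lambda>(x, y). f (x(i := y))) \<in> borel_measurable (PiM I (\<lambda>_. M) \<Otimes>\<^sub>M M)"
    using measurable_compose[OF measurable_add_dim insert.prems(1)] by (simp add: case_prod_unfold)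
  have meas1: "(\<lambda>y. f (x(i := y))) \<in> borel_measurable M" if "x \<in> space (PiM I (\<lambda>_. M))" for x
    using measurable_compose[OF measurable_component_update insert.prems(1), OF that insert.hyps(2)] .
  define F where "F x = (\<integral>y. f (x(i := y)) \<partial>M)" for x
  have F[measurable]: "F \<in> borel_measurable (PiM I (\<lambda>_. M))"
    unfolding F_def[abs_def] using meas2 by (rule M.borel_measurable_lebesgue_integral)
  have int_f: "integrable M (\<lambda>y. f (x(i := y)))" if "x \<in> space (PiM I (\<lambda>_. M))" for x
    using meas1[OF that] sp[OF that] insert.prems(2)
    by (intro M.integrable_const_bound[where B=B]) auto
  have FB: "\<bar>F x\<bar> \<le> B" if "x \<in> space (PiM I (\<lambda>_. M))" for x
  proof -
    have "f (x(i := y)) \<le> B" "- B \<le> f (x(i := y))" if "y \<in> space M" for y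
      using insert.prems(2)[OF sp[OF \<open>x \<in> _\<close> that]] unfolding abs_le_iff by linarith+
    then show ?thesis unfolding F_def
      using int_f[OF that] by (intro abs_leI, intro M.integral_le_const) (auto intro!: M.integral_ge_const simp: minus_le_iff)
  qed
  have step: "(\<integral>y. exp (f (x(i := y))) \<partial>M) \<le> exp (F x + c\<^sup>2 / 8)" if x: "x \<in> space (PiM I (\<lambda>_. M))" for x
    unfolding F_def
  proof (rule M.Hoeffding_mgf(2)[OF meas1[OF x]])
    fix y y' assume "y \<in> space M" "y' \<in> space M"
    then show "f (x(i := y)) - f (x(i := y')) \<le> c"
      using insert.prems(3)[OF sp[OF x, of y'], of i y] unfolding fun_upd_upd by blast
  qed
  have "exp (f x) \<le> exp B" if "x \<in> space (PiM (insert i I) (\<lambda>_. M))" for x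
    using insert.prems(2)[OF that] by auto
  then have "integrable (PiM (insert i I) (\<lambda>_. M)) (\<lambda>x. exp (f x))"
    by (intro iI.integrable_const_bound[where B="exp B"]) auto
  then have "(\<integral>x. exp (f x) \<partial>PiM (insert i I) (\<lambda>_. M)) = (\<integral>x. (\<integral>y. exp (f (x(i := y))) \<partial>M) \<partial>PiM I (\<lambda>_. M))"
    using insert.hyps by (intro product_integral_insert)
  also have "\<dots> \<le> (\<integral>x. exp (F x) * exp (c\<^sup>2 / 8) \<partial>PiM I (\<lambda>_. M))"
  proof (rule Bochner_Integration.integral_mono)
    show "integrable (PiM I (\<lambda>_. M)) (\<lambda>x. exp (F x) * exp (c\<^sup>2 / 8))"
      using FB by (intro integrable_mult_left I.integrable_const_bound[where B="exp B"]) (auto dest: abs_le_D1)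
    have "\<bar>\<integral>y. exp (f (x(i := y))) \<partial>M\<bar> \<le> exp (B + c\<^sup>2 / 8)" if "x \<in> space (PiM I (\<lambda>_. M))" for x
    proof -
      have "0 \<le> (\<integral>y. exp (f (x(i := y))) \<partial>M)" by simp
      then show ?thesis using step[OF that] FB[OF that] by (auto intro: order_trans dest: abs_le_D1)
    qed
    moreover have "(\<lambda>x. \<integral>y. exp (f (x(i := y))) \<partial>M) \<in> borel_measurable (PiM I (\<lambda>_. M))"
      using meas2 by (intro M.borel_measurable_lebesgue_integral) (simp add: case_prod_unfold)
    ultimately show "integrable (PiM I (\<lambda>_. M)) (\<lambda>x. \<integral>y. exp (f (x(i := y))) \<partial>M)"
      by (intro I.integrable_const_bound[where B="exp (B + c\<^sup>2 / 8)"]) auto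
  qed (use step in \<open>simp add: exp_add\<close>)
  also have "\<dots> = (\<integral>x. exp (F x) \<partial>PiM I (\<lambda>_. M)) * exp (c\<^sup>2 / 8)" by simp
  also have "\<dots> \<le> exp ((\<integral>x. F x \<partial>PiM I (\<lambda>_. M)) + card I * c\<^sup>2 / 8) * exp (c\<^sup>2 / 8)"
  proof (intro mult_right_mono insert.IH F FB)
    fix x j y assume x: "x \<in> space (PiM I (\<lambda>_. M))" and j: "j \<in> I" and y: "y \<in> space M"
    then have x': "x(j := y) \<in> space (PiM I (\<lambda>_. M))"
      by (auto simp: space_PiM PiE_def extensional_def)
    have "F (x(j := y)) - F x = (\<integral>z. f (x(j := y, i := z)) - f (x(i := z)) \<partial>M)"
      unfolding F_def using int_f x x' by (subst Bochner_Integration.integral_diff) auto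
    also have "\<dots> \<le> c"
    proof (intro M.integral_le_const AE_I2 Bochner_Integration.integrable_diff int_f x x')
      fix z assume z: "z \<in> space M"
      have "x(j := y, i := z) = x(i := z, j := y)"
        using j insert.hyps by (auto simp: fun_upd_twist)
      then show "f (x(j := y, i := z)) - f (x(i := z)) \<le> c"
        using insert.prems(3)[OF sp[OF x z] insertI2[OF j] y] by (simp only:)
    qed
    finally show "F (x(j := y)) - F x \<le> c" .
  qed auto
  also have "(\<integral>x. F x \<partial>PiM I (\<lambda>_. M)) = (\<integral>x. f x \<partial>PiM (insert i I) (\<lambda>_. M))"
    unfolding F_def
    using insert.hyps insert.prems(2)
    by (intro product_integral_insert[symmetric] iI.integrable_const_bound[where B=B]) auto
  also have "exp ((\<integral>x. f x \<partial>PiM (insert i I) (\<lambda>_. M)) + card I * c\<^sup>2 / 8) * exp (c\<^sup>2 / 8)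
      = exp ((\<integral>x. f x \<partial>PiM (insert i I) (\<lambda>_. M)) + card (insert i I) * c\<^sup>2 / 8)"
    using insert.hyps by (simp add: exp_add[symmetric] algebra_simps add_divide_distrib)
  finally show ?case .
qed

theorem McDiarmid_inequality:
  fixes f :: "('i \<Rightarrow> 'a) \<Rightarrow> real" and B c :: real
  assumes M: "prob_space M" and I: "finite I" "I \<noteq> {}"
    and f[measurable]: "f \<in> borel_measurable (PiM I (\<lambda>_. M))"
    and B: "\<And>x. x \<in> space (PiM I (\<lambda>_. M)) \<Longrightarrow> \<bar>f x\<bar> \<le> B"
    and diff: "\<And>x i y. x \<in> space (PiM I (\<lambda>_. M)) \<Longrightarrow> i \<in> I \<Longrightarrow> y \<in> space M \<Longrightarrow> f (x(i := y)) - f x \<le> c"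
    and c: "0 < c" and s: "0 \<le> s"
  shows "measure (PiM I (\<lambda>_. M)) {x \<in> space (PiM I (\<lambda>_. M)). (\<integral>x. f x \<partial>PiM I (\<lambda>_. M)) + s \<le> f x}
    \<le> exp (- 2 * s\<^sup>2 / (card I * c\<^sup>2))"
proof -
  let ?P = "PiM I (\<lambda>_. M)"
  interpret P: prob_space ?P by (intro prob_space_PiM M)
  define n where "n = real (card I)"
  have n: "0 < n" using I by (simp add: n_def card_gt_0_iff)
  show ?thesis
  proof (cases "s = 0")
    case False
    \<comment> \<open>This value minimizes the Chernoff exponent
      \<open>n * (l * c)\<^sup>2 / 8 - l * s\<close>.\<close>
    define l where "l = 4 * s / (n * c\<^sup>2)"
    have l: "0 < l" using False s n c by (auto simp: l_def)
    define m where "m = (\<integral>x. f x \<partial>?P)"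
    have bd: "exp (l * f x) \<le> exp (l * B)" if "x \<in> space ?P" for x
      using B[OF that] l by (auto dest: abs_le_D1)
    have eq: "{x \<in> space ?P. m + s \<le> f x} = {x \<in> space ?P. exp (l * (m + s)) \<le> exp (l * f x)}"
      using l by simp
    have "measure ?P {x \<in> space ?P. m + s \<le> f x} \<le> (\<integral>x. exp (l * f x) \<partial>?P) / exp (l * (m + s))"
      unfolding eq
      using bd by (intro integral_Markov_inequality_measure[where A="space ?P"] P.integrable_const_bound[where B="exp (l * B)"]) auto
    also have "\<dots> \<le> exp ((\<integral>x. l * f x \<partial>?P) + card I * (l * c)\<^sup>2 / 8) / exp (l * (m + s))"
    proof (intro divide_right_mono bounded_differences_mgf[where f="\<lambda>x. l * f x" and B="l * B"] M I(1))
      show "\<bar>l * f x\<bar> \<le> l * B" if "x \<in> space ?P" for x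
        using B[OF that] l by (simp add: abs_mult)
      show "l * f (x(i := y)) - l * f x \<le> l * c" if "x \<in> space ?P" "i \<in> I" "y \<in> space M" for x i y
        using diff[OF that] l by (simp add: right_diff_distrib[symmetric])
    qed auto
    also have "\<dots> = exp (n * (l * c)\<^sup>2 / 8 - l * s)"
      by (simp add: m_def n_def exp_diff[symmetric] algebra_simps)
    also have "n * (l * c)\<^sup>2 / 8 - l * s = - 2 * s\<^sup>2 / (n * c\<^sup>2)"
      using n c by (simp add: l_def power2_eq_square divide_simps)
    finally show ?thesis unfolding m_def n_def .
  qed simp
qed


text \<open>Exchanging \<open>\<omega> i\<close> with \<open>\<omega> (K + i)\<close> preserves the
  product measure and negates the \<open>i\<close>-th difference, so each difference may be averaged
  over its sign. The factor 2 comes from bounding sample and ghost sample separately. The set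
  \<open>S\<close> allows the bound \<open>R\<close> to be assumed at almost all points
  only.\<close>

lemma symmetrization:
  fixes a :: "'t \<Rightarrow> 'a \<Rightarrow> real" and c R :: real
  assumes M: "prob_space M" and T: "countable T" "T \<noteq> {}"
    and a: "\<And>t. t \<in> T \<Longrightarrow> a t \<in> borel_measurable M"
    and c: "\<And>t x. t \<in> T \<Longrightarrow> x \<in> space M \<Longrightarrow> \<bar>a t x\<bar> \<le> c"
    and S: "AE x in M. x \<in> S"
    and R: "\<And>ps. (\<And>k. k < K \<Longrightarrow> ps k \<in> space M \<inter> S) \<Longrightarrow>
      rademacher_sup T (map (\<lambda>k t. a t (ps k)) [0..<K]) (\<lambda>_. 0) \<le> R"
  shows "(\<integral>\<omega>. (SUP t\<in>T. \<Sum>k<K. a t (\<omega> (K + k)) - a t (\<omega> k)) \<partial>PiM {..<2 * K} (\<lambda>_. M)) \<le> 2 * R"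
proof -
  let ?P = "PiM {..<2 * K} (\<lambda>_. M)"
  interpret M: prob_space M by fact
  interpret P: prob_space ?P by (intro prob_space_PiM M)
  define D where "D k t \<omega> = a t (\<omega> (K + k)) - a t (\<omega> k)" for k t and \<omega> :: "nat \<Rightarrow> 'a"
  \<comment> \<open>Interpolation: in \<open>V i\<close> the first \<open>i\<close> differences are
    left as they are and the later ones carry signs, so \<open>V K\<close> is the integrand and
    \<open>V 0\<close> a Rademacher average for each fixed \<open>\<omega>\<close>.\<close>
  define V where "V i \<omega> = rademacher_sup T (map (\<lambda>k t. D k t \<omega>) [i..<K]) (\<lambda>t. \<Sum>k<i. D k t \<omega>)" for i \<omega>
  have comp: "\<omega> k \<in> space M" if "\<omega> \<in> space ?P" "k < 2 * K" for \<omega> k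
    using that by (auto simp: space_PiM)
  have D_meas: "(\<lambda>\<omega>. D k t \<omega>) \<in> borel_measurable ?P" if "k < K" "t \<in> T" for k t
  proof -
    have "(\<lambda>\<omega>. a t (\<omega> j)) \<in> borel_measurable ?P" if "j < 2 * K" for j
      using that a[OF \<open>t \<in> T\<close>] by (intro measurable_compose[OF measurable_component_singleton]) auto
    then show ?thesis unfolding D_def using that by (intro borel_measurable_diff) auto
  qed
  have D_bd: "\<bar>D k t \<omega>\<bar> \<le> 2 * c" if "k < K" "t \<in> T" "\<omega> \<in> space ?P" for k t \<omega>
    using c[OF that(2) comp[OF that(3), of k]] c[OF that(2) comp[OF that(3), of "K + k"]] that(1)
    unfolding D_def by linarith
  have sum_bd: "\<bar>\<Sum>k<i. D k t \<omega>\<bar> \<le> real i * (2 * c)" if "i \<le> K" "t \<in> T" "\<omega> \<in> space ?P" for i t \<omega>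
    using that by (intro order_trans[OF sum_abs] sum_bounded_above[THEN order_trans]) (auto intro!: D_bd)
  have V_meas: "V i \<in> borel_measurable ?P" if "i \<le> K" for i
    unfolding V_def[abs_def] using that
    by (intro rademacher_sup_measurable[where B="real i * (2 * c)" and c="2 * c"] T borel_measurable_sum
        D_meas D_bd sum_bd) auto
  have V_int: "integrable ?P (V i)" if "i \<le> K" for i
  proof (rule P.integrable_const_bound[OF _ V_meas[OF that]])
    have "\<bar>V i \<omega>\<bar> \<le> real i * (2 * c) + length (map (\<lambda>k t. D k t \<omega>) [i..<K]) * (2 * c)" if "\<omega> \<in> space ?P" for \<omega>
      unfolding V_def using that \<open>i \<le> K\<close> by (intro rademacher_sup_abs_le T) (auto intro: sum_bd D_bd)
    then show "AE \<omega> in ?P. norm (V i \<omega>) \<le> real i * (2 * c) + (K - i) * (2 * c)" by auto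
  qed
  have V_step: "(\<integral>\<omega>. V i \<omega> \<partial>?P) = (\<integral>\<omega>. V (Suc i) \<omega> \<partial>?P)" if i: "i < K" for i
  proof -
    define \<pi> where "\<pi> n = (if n = i then K + i else if n = K + i then i else n)" for n
    define sw where "sw \<omega> = (\<lambda>n\<in>{..<2 * K}. \<omega> (\<pi> n))" for \<omega> :: "nat \<Rightarrow> 'a"
    have \<pi>: "inj_on \<pi> {..<2 * K}" "\<pi> \<in> {..<2 * K} \<rightarrow> {..<2 * K}"
      using i by (auto simp: \<pi>_def inj_on_def)
    have sw_meas: "sw \<in> ?P \<rightarrow>\<^sub>M ?P"
      unfolding sw_def[abs_def] using \<pi>(2) by (intro measurable_restrict measurable_component_singleton) auto
    have sw_distr: "distr ?P ?P sw = ?P"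
      using distr_PiM_reindex[of "{..<2 * K}" "\<lambda>_. M" \<pi> "{..<2 * K}"] \<pi> M unfolding sw_def[abs_def] by simp
    have D_sw: "D k t (sw \<omega>) = (if k = i then - D i t \<omega> else D k t \<omega>)" if "k < K" for k t \<omega>
      using that i by (auto simp: D_def sw_def \<pi>_def)
    have V_sw: "V (Suc i) (sw \<omega>) = rademacher_sup T (map (\<lambda>k t. D k t \<omega>) [Suc i..<K]) (\<lambda>t. (\<Sum>k<i. D k t \<omega>) - D i t \<omega>)" for \<omega>
      unfolding V_def
    proof (rule rademacher_sup_cong)
      have "(\<Sum>k<i. D k t (sw \<omega>)) = (\<Sum>k<i. D k t \<omega>)" for t
        using i by (intro sum.cong refl) (simp add: D_sw)
      then show "(\<Sum>k<Suc i. D k t (sw \<omega>)) = (\<Sum>k<i. D k t \<omega>) - D i t \<omega>" for t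
        using i by (simp add: D_sw)
    qed (auto simp: list.rel_map list_all2_same D_sw)
    have "V i = (\<lambda>\<omega>. (V (Suc i) \<omega> + V (Suc i) (sw \<omega>)) / 2)"
      unfolding V_sw using i by (simp add: V_def upt_conv_Cons fun_eq_iff)
    then have "(\<integral>\<omega>. V i \<omega> \<partial>?P) = (\<integral>\<omega>. (V (Suc i) \<omega> + V (Suc i) (sw \<omega>)) / 2 \<partial>?P)" by (simp only:)
    also have "\<dots> = ((\<integral>\<omega>. V (Suc i) \<omega> \<partial>?P) + (\<integral>\<omega>. V (Suc i) (sw \<omega>) \<partial>?P)) / 2"
    proof -
      have "integrable ?P (\<lambda>\<omega>. V (Suc i) (sw \<omega>))"
        using i V_int[of "Suc i"] by (intro integrable_distr[OF sw_meas]) (simp add: sw_distr)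
      then show ?thesis using i V_int[of "Suc i"] by simp
    qed
    also have "(\<integral>\<omega>. V (Suc i) (sw \<omega>) \<partial>?P) = (\<integral>\<omega>. V (Suc i) \<omega> \<partial>distr ?P ?P sw)"
      using i by (intro integral_distr[symmetric] sw_meas V_meas) auto
    finally show ?thesis by (simp add: sw_distr)
  qed
  have "(\<integral>\<omega>. V 0 \<omega> \<partial>?P) = (\<integral>\<omega>. V i \<omega> \<partial>?P)" if "i \<le> K" for i
    using that by (induction i) (simp_all add: V_step)
  then have "(\<integral>\<omega>. V K \<omega> \<partial>?P) = (\<integral>\<omega>. V 0 \<omega> \<partial>?P)" by (metis order_refl)
  also have "\<dots> \<le> 2 * R"
  proof (rule P.integral_le_const[OF V_int])
    have "AE \<omega> in ?P. \<forall>k\<in>{..<2 * K}. \<omega> k \<in> S"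
      using S M by (intro AE_finite_allI) (auto intro: AE_PiM_component[of "{..<2 * K}" "\<lambda>_. M" _ "\<lambda>x. x \<in> S"])
    then show "AE \<omega> in ?P. V 0 \<omega> \<le> 2 * R"
    proof (rule AE_mp, intro AE_I2 impI)
      fix \<omega> assume \<omega>: "\<omega> \<in> space ?P" "\<forall>k\<in>{..<2 * K}. \<omega> k \<in> S"
      have bd: "bounded ((\<lambda>t. a t (\<omega> k)) ` T)" "bounded ((\<lambda>t. - a t (\<omega> k)) ` T)" if "k < 2 * K" for k
        using c[OF _ comp[OF \<omega>(1) that]] by (auto intro!: boundedI[where B=c])
      have z: "bounded ((\<lambda>_. 0::real) ` T)" by (auto intro!: boundedI[where B=0])
      have "V 0 \<omega> = rademacher_sup T (map2 (\<lambda>a b t. a t + b t) (map (\<lambda>k t. a t (\<omega> (K + k))) [0..<K])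
          (map (\<lambda>k t. - a t (\<omega> k)) [0..<K])) (\<lambda>t. 0 + 0)"
        unfolding V_def D_def
        by (intro rademacher_sup_cong) (auto simp: list_all2_conv_all_nth)
      also have "\<dots> \<le> rademacher_sup T (map (\<lambda>k t. a t (\<omega> (K + k))) [0..<K]) (\<lambda>_. 0)
          + rademacher_sup T (map (\<lambda>k t. - a t (\<omega> k)) [0..<K]) (\<lambda>_. 0)"
        by (rule rademacher_sup_add) (auto simp: T intro!: bd z)
      also have "rademacher_sup T (map (\<lambda>k t. - a t (\<omega> k)) [0..<K]) (\<lambda>_. 0)
          = rademacher_sup T (map (\<lambda>k t. a t (\<omega> k)) [0..<K]) (\<lambda>_. 0)"
        by (rule rademacher_sup_uminus)
      also have "rademacher_sup T (map (\<lambda>k t. a t (\<omega> (K + k))) [0..<K]) (\<lambda>_. 0)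
          + rademacher_sup T (map (\<lambda>k t. a t (\<omega> k)) [0..<K]) (\<lambda>_. 0) \<le> R + R"
        using \<omega> by (intro add_mono R) (auto simp: comp)
      finally show "V 0 \<omega> \<le> 2 * R" by simp
    qed
  qed simp
  finally show ?thesis by (simp add: V_def D_def)
qed

text \<open>The ghost integral of the supremum is at least the supremum of the expected deviations,
  and it lets the approximating \<open>t\<close> depend on the ghost sample. The sums are not
  divided by \<open>K\<close>, so one sample point changes the integral by at most 1.\<close>

lemma uniform_deviation:
  fixes a :: "'t \<Rightarrow> 'a \<Rightarrow> real" and R \<delta> :: real
  assumes M: "prob_space M" and T: "countable T" "T \<noteq> {}" and K: "1 \<le> K"
    and a: "\<And>t. t \<in> T \<Longrightarrow> a t \<in> borel_measurable M"
    and a01: "\<And>t x. t \<in> T \<Longrightarrow> x \<in> space M \<Longrightarrow> a t x \<in> {0..1}"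
    and S: "AE x in M. x \<in> S"
    and R: "\<And>ps. (\<And>k. k < K \<Longrightarrow> ps k \<in> space M \<inter> S) \<Longrightarrow>
      rademacher_sup T (map (\<lambda>k t. a t (ps k)) [0..<K]) (\<lambda>_. 0) \<le> R"
    and \<delta>: "0 < \<delta>" "\<delta> < 1"
  shows "\<exists>A\<in>sets (PiM {..<K} (\<lambda>_. M)). 1 - \<delta> \<le> measure (PiM {..<K} (\<lambda>_. M)) A \<and>
    (\<forall>ps\<in>A. integrable (PiM {K..<2 * K} (\<lambda>_. M)) (\<lambda>qs. SUP t\<in>T. \<Sum>k<K. a t (qs (K + k)) - a t (ps k)) \<and>
      (\<integral>qs. (SUP t\<in>T. \<Sum>k<K. a t (qs (K + k)) - a t (ps k)) \<partial>PiM {K..<2 * K} (\<lambda>_. M))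
        \<le> 2 * R + sqrt (K * ln (1 / \<delta>) / 2))"
proof -
  let ?I = "{..<K}" and ?J = "{K..<2 * K}"
  let ?PI = "PiM ?I (\<lambda>_. M)" and ?PJ = "PiM ?J (\<lambda>_. M)" and ?P = "PiM {..<2 * K} (\<lambda>_. M)"
  interpret M: prob_space M by fact
  interpret product_sigma_finite "\<lambda>_. M" by unfold_locales
  interpret PI: prob_space ?PI by (intro prob_space_PiM M)
  interpret PJ: prob_space ?PJ by (intro prob_space_PiM M)
  interpret PP: prob_space ?P by (intro prob_space_PiM M)
  have un: "?I \<union> ?J = {..<2 * K}" by auto
  define f where "f ps qs t = (\<Sum>k<K. a t (qs (K + k)) - a t (ps k))" for ps qs :: "nat \<Rightarrow> 'a" and t
  define Z where "Z ps qs = (SUP t\<in>T. f ps qs t)" for ps qs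
  have compI: "ps k \<in> space M" if "ps \<in> space ?PI" "k < K" for ps k using that by (auto simp: space_PiM)
  have compJ: "qs (K + k) \<in> space M" if "qs \<in> space ?PJ" "k < K" for qs k using that by (auto simp: space_PiM)
  have f_bd: "\<bar>f ps qs t\<bar> \<le> K" if "t \<in> T" "\<And>k. k < K \<Longrightarrow> ps k \<in> space M" "\<And>k. k < K \<Longrightarrow> qs (K + k) \<in> space M" for ps qs t
  proof -
    have "\<bar>f ps qs t\<bar> \<le> (\<Sum>k<K. \<bar>a t (qs (K + k)) - a t (ps k)\<bar>)" unfolding f_def by (rule sum_abs)
    also have "\<dots> \<le> (\<Sum>k<K. 1)"
    proof (rule sum_mono)
      fix k assume "k \<in> {..<K}"
      then show "\<bar>a t (qs (K + k)) - a t (ps k)\<bar> \<le> 1"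
        using a01[OF that(1) that(2)[of k]] a01[OF that(1) that(3)[of k]] by auto
    qed
    finally show ?thesis by simp
  qed
  have f_bdd: "bounded (f ps qs ` T)" if "ps \<in> space ?PI" "qs \<in> space ?PJ" for ps qs
    using f_bd compI[OF that(1)] compJ[OF that(2)] by (intro boundedI[where B="real K"]) auto
  have Z_bd: "\<bar>Z ps qs\<bar> \<le> K" if "ps \<in> space ?PI" "qs \<in> space ?PJ" for ps qs
    using rademacher_sup_abs_le[OF T(2), of "f ps qs" "real K" "[]"] f_bd compI[OF that(1)] compJ[OF that(2)]
    by (simp add: Z_def)
  have a_meas: "(\<lambda>\<omega>. a t (X \<omega>)) \<in> borel_measurable N" if "t \<in> T" "X \<in> N \<rightarrow>\<^sub>M M" for t X and N :: "'n measure"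
    using measurable_compose[OF that(2) a[OF that(1)]] .
  have Z_meas: "(\<lambda>\<omega>. Z (X \<omega>) (Y \<omega>)) \<in> borel_measurable N"
    if X: "X \<in> N \<rightarrow>\<^sub>M ?PI" and Y: "Y \<in> N \<rightarrow>\<^sub>M ?PJ" for X Y and N :: "'n measure"
    unfolding Z_def
  proof (rule borel_measurable_cSUP[OF T(1)])
    show "(\<lambda>\<omega>. f (X \<omega>) (Y \<omega>) t) \<in> borel_measurable N" if "t \<in> T" for t
      unfolding f_def using that X Y
      by (intro borel_measurable_sum borel_measurable_diff a_meas)
        (auto intro!: measurable_compose[OF X measurable_component_singleton] measurable_compose[OF Y measurable_component_singleton])
    show "bdd_above ((\<lambda>t. f (X \<omega>) (Y \<omega>) t) ` T)" if "\<omega> \<in> space N" for \<omega>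
      using f_bdd[OF measurable_space[OF X that] measurable_space[OF Y that]] by (simp add: bounded_imp_bdd_above)
  qed
  have Z_int: "integrable ?PJ (Z ps)" if "ps \<in> space ?PI" for ps
    using Z_bd[OF that] Z_meas[of "\<lambda>_. ps" ?PJ "\<lambda>q. q"] that
    by (intro PJ.integrable_const_bound[where B="real K"]) auto
  define G where "G ps = (\<integral>qs. Z ps qs \<partial>?PJ)" for ps
  have G_meas[measurable]: "G \<in> borel_measurable ?PI"
    unfolding G_def[abs_def]
    using Z_meas[of fst "?PI \<Otimes>\<^sub>M ?PJ" snd]
    by (intro PJ.borel_measurable_lebesgue_integral) (simp add: case_prod_unfold)
  have G_bd: "\<bar>G ps\<bar> \<le> K" if "ps \<in> space ?PI" for ps
  proof -
    have "Z ps qs \<le> K" "- K \<le> Z ps qs" if "qs \<in> space ?PJ" for qs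
      using Z_bd[OF \<open>ps \<in> _\<close> that] by linarith+
    then have "G ps \<le> K" "- K \<le> G ps"
      unfolding G_def by (auto intro!: PJ.integral_le_const PJ.integral_ge_const Z_int that)
    then show ?thesis by linarith
  qed
  have G_diff: "G (ps(i := y)) - G ps \<le> 1" if ps: "ps \<in> space ?PI" and i: "i \<in> ?I" and y: "y \<in> space M" for ps i y
  proof -
    have ps': "ps(i := y) \<in> space ?PI" using that by (auto simp: space_PiM PiE_def extensional_def)
    have "Z (ps(i := y)) qs \<le> Z ps qs + 1" if qs: "qs \<in> space ?PJ" for qs
      unfolding Z_def
    proof (rule cSUP_least[OF T(2)])
      fix t assume t: "t \<in> T"
      have "f (ps(i := y)) qs t - f ps qs t = (\<Sum>k<K. if k = i then a t (ps i) - a t y else 0)"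
        unfolding f_def sum_subtractf[symmetric] by (intro sum.cong) auto
      also have "\<dots> \<le> 1"
        using i a01[OF t compI[OF ps, of i]] a01[OF t y] by simp
      finally have "f (ps(i := y)) qs t \<le> f ps qs t + 1" by simp
      also have "f ps qs t \<le> (SUP t\<in>T. f ps qs t)"
        using f_bdd[OF ps qs] t by (rule le_cSUP_bounded)
      finally show "f (ps(i := y)) qs t \<le> (SUP t\<in>T. f ps qs t) + 1" by simp
    qed
    then have "G (ps(i := y)) \<le> (\<integral>qs. Z ps qs + 1 \<partial>?PJ)"
      unfolding G_def using Z_int[OF ps] Z_int[OF ps'] by (intro Bochner_Integration.integral_mono) auto
    also have "\<dots> = G ps + 1"
      unfolding G_def using Z_int[OF ps] by (simp add: PJ.prob_space)
    finally show ?thesis by simp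
  qed
  \<comment> \<open>Solves \<open>exp (- 2 * s\<^sup>2 / K) = \<delta>\<close>, the one-sided tail
    for \<open>K\<close> coordinates with differences at most 1.\<close>
  define s where "s = sqrt (K * ln (1 / \<delta>) / 2)"
  have ln\<delta>: "0 < ln (1 / \<delta>)" using \<delta> by simp
  define A where "A = {ps \<in> space ?PI. G ps \<le> PI.expectation G + s}"
  have A: "A \<in> sets ?PI" unfolding A_def by measurable
  have "1 - PI.prob A = PI.prob (space ?PI - A)" using A by (simp add: PI.prob_compl)
  also have "\<dots> \<le> PI.prob {ps \<in> space ?PI. PI.expectation G + s \<le> G ps}"
    by (intro PI.finite_measure_mono) (auto simp: A_def)
  also have "\<dots> \<le> exp (- 2 * s\<^sup>2 / (card ?I * (1::real)\<^sup>2))"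
    using K M ln\<delta> by (intro McDiarmid_inequality[where B="real K"] G_meas G_bd G_diff) (auto simp: s_def lessThan_empty_iff)
  also have "\<dots> = \<delta>"
  proof -
    have "s\<^sup>2 = K * ln (1 / \<delta>) / 2" using ln\<delta> by (simp add: s_def)
    then have "- 2 * s\<^sup>2 / (card ?I * (1::real)\<^sup>2) = ln \<delta>" using K \<delta> by (simp add: ln_div)
    then show ?thesis using \<delta> by simp
  qed
  finally have "1 - \<delta> \<le> PI.prob A" by simp
  moreover have "G ps \<le> 2 * R + s" "integrable ?PJ (Z ps)" if "ps \<in> A" for ps
  proof -
    \<comment> \<open>By Fubini the mean of \<open>G\<close> is the integral over both samples
      jointly, to which symmetrization applies.\<close>
    have mg: "merge ?I ?J (x, y) k = x k" "merge ?I ?J (x, y) (K + k) = y (K + k)" if "k < K" for k x y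
      unfolding merge_def using that by simp_all
    have "integrable (PiM (?I \<union> ?J) (\<lambda>_. M)) (\<lambda>\<omega>. Z (restrict \<omega> ?I) (restrict \<omega> ?J))"
      unfolding un
    proof (rule PP.integrable_const_bound)
      have "restrict \<omega> ?I \<in> space ?PI" "restrict \<omega> ?J \<in> space ?PJ" if "\<omega> \<in> space ?P" for \<omega>
        using that unfolding space_PiM restrict_PiE_iff by (simp_all add: PiE_iff)
      then show "AE \<omega> in ?P. norm (Z (restrict \<omega> ?I) (restrict \<omega> ?J)) \<le> real K"
        by (intro AE_I2) (simp add: Z_bd)
      show "(\<lambda>\<omega>. Z (restrict \<omega> ?I) (restrict \<omega> ?J)) \<in> borel_measurable ?P"
        by (intro Z_meas measurable_restrict_subset) auto
    qed
    then have "integral\<^sup>L (PiM (?I \<union> ?J) (\<lambda>_. M)) (\<lambda>\<omega>. Z (restrict \<omega> ?I) (restrict \<omega> ?J)) = PI.expectation G"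
      by (subst product_integral_fold) (auto simp: G_def[abs_def] Z_def[abs_def] f_def mg)
    moreover have "Z (restrict \<omega> ?I) (restrict \<omega> ?J) = (SUP t\<in>T. \<Sum>k<K. a t (\<omega> (K + k)) - a t (\<omega> k))" for \<omega>
      by (simp add: Z_def f_def)
    moreover have "(\<integral>\<omega>. (SUP t\<in>T. \<Sum>k<K. a t (\<omega> (K + k)) - a t (\<omega> k)) \<partial>?P) \<le> 2 * R"
      using a01 by (intro symmetrization[where c=1 and S=S] M T a S R) auto
    ultimately have "PI.expectation G \<le> 2 * R" by (simp add: un)
    then show "G ps \<le> 2 * R + s" using that by (simp add: A_def)
    show "integrable ?PJ (Z ps)" using that by (intro Z_int) (simp add: A_def)
  qed
  ultimately show ?thesis
    using A unfolding G_def Z_def f_def s_def by (intro bexI[of _ A]) auto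
qed

subsection \<open>Expenditure shares and their features\<close>

lemma softmax_bounds:
  assumes "j < n"
  shows "softmax n v j \<in> {0..1}"
proof -
  have pos: "0 < (\<Sum>i<n. exp (v i))" using assms by (intro sum_pos) auto
  have "exp (v j) \<le> (\<Sum>i<n. exp (v i))" using assms by (intro member_le_sum) auto
  then show ?thesis using assms pos by (simp add: softmax_def)
qed

text \<open>Numerator and denominator change by a factor of at most \<open>exp e\<close> each. As
  shares are at most 1 and \<open>1 - 2 * e \<le> exp (- (2 * e))\<close>, the factor
  \<open>exp (2 * e)\<close> becomes an additive error.\<close>

lemma softmax_le_add:
  assumes j: "j < n" and e: "\<And>l. l < n \<Longrightarrow> \<bar>v l - v' l\<bar> \<le> e"
  shows "softmax n v' j \<le> softmax n v j + 2 * e"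
proof -
  have pos: "0 < (\<Sum>i<n. exp (v i))" "0 < (\<Sum>i<n. exp (v' i))" using j by (auto intro!: sum_pos)
  have "(\<Sum>i<n. exp (v i)) \<le> (\<Sum>i<n. exp e * exp (v' i))"
  proof (rule sum_mono)
    fix i assume "i \<in> {..<n}"
    then have "v i \<le> e + v' i" using e[of i] by (auto simp: abs_le_iff)
    then show "exp (v i) \<le> exp e * exp (v' i)" by (simp add: exp_add[symmetric])
  qed
  also have "\<dots> = exp e * (\<Sum>i<n. exp (v' i))" by (simp add: sum_distrib_left)
  finally have den: "(\<Sum>i<n. exp (v i)) \<le> exp e * (\<Sum>i<n. exp (v' i))" .
  have num: "exp (v' j) \<le> exp e * exp (v j)"
  proof -
    have "v' j \<le> e + v j" using e[OF j] by (auto simp: abs_le_iff)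
    then show ?thesis by (simp add: exp_add[symmetric])
  qed
  have "softmax n v' j * exp (- (2 * e)) = exp (v' j) * exp (- e) / ((\<Sum>i<n. exp (v' i)) * exp e)"
  proof -
    have "exp (- (2 * e)) = exp (- e) / exp e" by (simp add: exp_diff[symmetric])
    then show ?thesis using j by (simp add: softmax_def)
  qed
  also have "\<dots> \<le> exp (v j) / (\<Sum>i<n. exp (v i))"
    using num den pos by (intro frac_le) (auto simp: exp_minus field_simps)
  finally have 1: "softmax n v' j * exp (- (2 * e)) \<le> softmax n v j" using j by (simp add: softmax_def)
  have "1 - 2 * e \<le> exp (- (2 * e))" using exp_ge_add_one_self[of "- (2 * e)"] by simp
  then have "softmax n v' j * (1 - 2 * e) \<le> softmax n v' j * exp (- (2 * e))"
    using softmax_bounds[OF j, of v'] by (intro mult_left_mono) auto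
  moreover have "softmax n v' j * (2 * e) \<le> 1 * (2 * e)"
    using softmax_bounds[OF j, of v'] e[OF j] by (intro mult_right_mono) auto
  ultimately show ?thesis using 1 by (simp add: algebra_simps)
qed

lemma softmax_lipschitz:
  assumes "j < n" "\<And>l. l < n \<Longrightarrow> \<bar>v l - v' l\<bar> \<le> e"
  shows "\<bar>softmax n v j - softmax n v' j\<bar> \<le> 2 * e"
  using softmax_le_add[of j n v v' e] softmax_le_add[of j n v' v e] assms
  by (simp add: abs_minus_commute abs_le_iff)

lemma sup_loss_attained:
  assumes "1 \<le> n"
  obtains j where "j < n" "sup_loss n x z = \<bar>x j - z j\<bar>"
proof -
  have "sup_loss n x z \<in> (\<lambda>j. \<bar>x j - z j\<bar>) ` {..<n}"
    unfolding sup_loss_def using assms by (intro Max_in) (auto simp: lessThan_empty_iff)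
  then show ?thesis using that by auto
qed

lemma sup_loss_ge: "j < n \<Longrightarrow> \<bar>x j - z j\<bar> \<le> sup_loss n x z"
  unfolding sup_loss_def by (intro Max_ge) auto

text \<open>The coordinate attaining the larger of the two losses works, because \<open>z\<close> is
  the same in both. The existential form is what contraction asks of the features.\<close>

lemma sup_loss_lipschitz:
  assumes "1 \<le> n"
  shows "\<exists>j<n. \<bar>sup_loss n x z - sup_loss n x' z\<bar> \<le> \<bar>x j - x' j\<bar>"
proof -
  obtain j where j: "j < n" "sup_loss n x z = \<bar>x j - z j\<bar>" using sup_loss_attained[OF assms] .
  obtain j' where j': "j' < n" "sup_loss n x' z = \<bar>x' j' - z j'\<bar>" using sup_loss_attained[OF assms] .
  show ?thesis
  proof (cases "sup_loss n x' z \<le> sup_loss n x z")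
    case True
    then show ?thesis using j sup_loss_ge[OF j(1), of x' z] by (intro exI[of _ j]) auto
  next
    case False
    then show ?thesis using j' sup_loss_ge[OF j'(1), of x z] by (intro exI[of _ j']) auto
  qed
qed

lemma sup_loss_bounds:
  assumes "1 \<le> n" "\<And>j. j < n \<Longrightarrow> x j \<in> {0..1}" "\<And>j. j < n \<Longrightarrow> z j \<in> {0..1}"
  shows "sup_loss n x z \<in> {0..1}"
proof -
  obtain j where j: "j < n" "sup_loss n x z = \<bar>x j - z j\<bar>" using sup_loss_attained[OF assms(1)] .
  then show ?thesis using assms(2)[OF j(1)] assms(3)[OF j(1)] by auto
qed

lemma market_share_bounds:
  assumes "real_market n m u w x" "p \<in> pos_simplex n" "j < n"
  shows "market_share n m x p j \<in> {0..1}"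
proof -
  have p: "0 \<le> p l" if "l < n" for l
    using assms(2) that by (auto simp: pos_simplex_def intro: less_imp_le)
  have x: "x i p \<in> budget_set n p (w i p)" if "i < m" for i
    using assms(1,2) that by (auto simp: real_market_def is_arg_max_def)
  have nn: "0 \<le> x i p l" if "i < m" "l < n" for i l
    using x[OF that(1)] that(2) by (auto simp: budget_set_def orthant_def PiE_iff)
  have eq: "market_share n m x p j = (\<Sum>i<m. p j * x i p j)"
    using assms(3) by (simp add: market_share_def aggregate_demand_def sum_distrib_left)
  have "(\<Sum>i<m. p j * x i p j) \<le> (\<Sum>i<m. w i p)"
  proof (rule sum_mono)
    fix i assume "i \<in> {..<m}"
    then have i: "i < m" by simp
    have "p j * x i p j \<le> (\<Sum>l<n. p l * x i p l)"
      using assms(3) p nn[OF i] by (intro member_le_sum[where f="\<lambda>l. p l * x i p l"]) auto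
    also have "\<dots> \<le> w i p" using x[OF i] by (simp add: budget_set_def)
    finally show "p j * x i p j \<le> w i p" .
  qed
  also have "\<dots> = 1" using assms(1,2) by (auto simp: real_market_def)
  finally show ?thesis
    unfolding eq using p[OF assms(3)] nn assms(3) by (auto intro!: sum_nonneg mult_nonneg_nonneg)
qed

text \<open>The flag chooses between CES shares, with Cobb-Douglas at \<open>\<sigma> = 0\<close>
  and Leontief at \<open>\<sigma> = -1\<close>, and linear shares. The union of the component
  classes thus costs a single further feature, the flag.\<close>

type_synonym share_param = "bool \<times> (nat \<Rightarrow> real) \<times> real \<times> (nat \<times> nat \<Rightarrow> real)"

(* For linear shares the thresholds y i - y l of the comparisons of goods are decoupled into a free matrix q.
   This makes each comparison a one-parameter class and allows approximation from below by rational q. *)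
fun param_share :: "nat \<Rightarrow> (nat set \<Rightarrow> nat) \<Rightarrow> share_param \<Rightarrow> (nat \<Rightarrow> real) \<Rightarrow> nat \<Rightarrow> real" where
  "param_share n tb (c, y, \<sigma>, q) p j =
    (if c then softmax n (\<lambda>l. y l - \<sigma> * ln (p l)) j
     else of_bool (j = tb {l. l < n \<and> (\<forall>i<n. \<not> ln (p i) - ln (p l) < q (i, l))}))"

text \<open>The factor 4 arises as 2 times 2: \<open>softmax\<close> is 2-Lipschitz for the sup
  norm, and each entry of its argument is a difference of two terms, whose change is at most twice
  the larger of their changes.\<close>

definition share_features :: "nat \<Rightarrow> (share_param \<Rightarrow> (nat \<Rightarrow> real) \<Rightarrow> real) list" where
  "share_features n =
    [\<lambda>(c, y, \<sigma>, q) p. of_bool c]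
    @ map (\<lambda>l (c, y, \<sigma>, q) p. 4 * y l) [0..<n]
    @ map (\<lambda>l (c, y, \<sigma>, q) p. 4 * \<sigma> * ln (p l)) [0..<n]
    @ map (\<lambda>(i, l) (c, y, \<sigma>, q) p. of_bool (ln (p i) - ln (p l) < q (i, l))) (List.product [0..<n] [0..<n])"

text \<open>For a matrix \<open>q\<close> not of the form \<open>y i - y l\<close>, the set given to
  \<open>tb\<close> can be empty and the result can leave the simplex. The bounds on single entries
  survive and are what the loss bound relies on.\<close>

lemma param_share_bounds: "j < n \<Longrightarrow> param_share n tb \<theta> p j \<in> {0..1}"
  using softmax_bounds by (cases \<theta>) auto

text \<open>Otherwise every feature changes by less than the share does, hence by less than 1. Then
  the two-valued features agree, so either both shares are linear and equal, or both are softmax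
  values whose arguments are too close for their distance.\<close>

lemma param_share_lipschitz:
  assumes j: "j < n"
  shows "\<exists>F\<in>set (share_features n). \<bar>param_share n tb \<theta> p j - param_share n tb \<theta>' p j\<bar> \<le> \<bar>F \<theta> p - F \<theta>' p\<bar>"
proof -
  obtain c y \<sigma> q where \<theta>: "\<theta> = (c, y, \<sigma>, q)" by (cases \<theta>)
  obtain c' y' \<sigma>' q' where \<theta>': "\<theta>' = (c', y', \<sigma>', q')" by (cases \<theta>')
  let ?d = "\<bar>param_share n tb \<theta> p j - param_share n tb \<theta>' p j\<bar>"
  have d1: "?d \<le> 1"
    using param_share_bounds[OF j, of tb \<theta> p] param_share_bounds[OF j, of tb \<theta>' p] by auto
  show ?thesis
  proof (rule ccontr)
    assume "\<not> ?thesis"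
    then have less: "\<bar>F \<theta> p - F \<theta>' p\<bar> < ?d" if "F \<in> set (share_features n)" for F
      using that by force
    have c: "c = c'" using less[of "\<lambda>(c, y, \<sigma>, q) p. of_bool c"] d1
      by (cases c; cases c') (auto simp: share_features_def \<theta> \<theta>')
    have y: "\<bar>4 * y l - 4 * y' l\<bar> < ?d" if "l < n" for l
      using less[of "\<lambda>(c, y, \<sigma>, q) p. 4 * y l"] that by (auto simp: share_features_def \<theta> \<theta>')
    have \<sigma>: "\<bar>4 * \<sigma> * ln (p l) - 4 * \<sigma>' * ln (p l)\<bar> < ?d" if "l < n" for l
      using less[of "\<lambda>(c, y, \<sigma>, q) p. 4 * \<sigma> * ln (p l)"] that by (auto simp: share_features_def \<theta> \<theta>')
    have "(\<lambda>(c, y, \<sigma>, q) p. of_bool (ln (p i) - ln (p l) < q (i, l))) \<in> set (share_features n)" if "i < n" "l < n" for i l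
    proof -
      let ?f = "(\<lambda>(i, l) (c, y, \<sigma>, q) p. of_bool (ln (p i) - ln (p l) < q (i, l)))
        :: nat \<times> nat \<Rightarrow> share_param \<Rightarrow> (nat \<Rightarrow> real) \<Rightarrow> real"
      have "?f (i, l) \<in> set (map ?f (List.product [0..<n] [0..<n]))"
        unfolding set_map using that by (intro imageI) auto
      then show ?thesis unfolding share_features_def by simp
    qed
    then have q: "ln (p i) - ln (p l) < q (i, l) \<longleftrightarrow> ln (p i) - ln (p l) < q' (i, l)" if "i < n" "l < n" for i l
      using less[of "\<lambda>(c, y, \<sigma>, q) p. of_bool (ln (p i) - ln (p l) < q (i, l))"] d1 that
      by (auto simp: \<theta> \<theta>' of_bool_def split: if_splits)
    show False
    proof (cases c)
      case True
      define e where "e = (MAX l\<in>{..<n}. \<bar>(y l - \<sigma> * ln (p l)) - (y' l - \<sigma>' * ln (p l))\<bar>)"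
      have "e \<in> (\<lambda>l. \<bar>(y l - \<sigma> * ln (p l)) - (y' l - \<sigma>' * ln (p l))\<bar>) ` {..<n}"
        unfolding e_def using j by (intro Max_in) auto
      then obtain l where l: "l < n" "e = \<bar>(y l - \<sigma> * ln (p l)) - (y' l - \<sigma>' * ln (p l))\<bar>" by auto
      have aux: "2 * \<bar>r - s - (r' - s')\<bar> < d" if "\<bar>4 * r - 4 * r'\<bar> < d" "\<bar>4 * s - 4 * s'\<bar> < d" for r s r' s' d :: real
      proof -
        have "\<bar>r - s - (r' - s')\<bar> < d / 2" using that unfolding abs_less_iff by linarith
        then show ?thesis by simp
      qed
      have "2 * e < ?d"
        unfolding l(2) by (rule aux) (use y[OF l(1)] \<sigma>[OF l(1)] in \<open>simp_all only: mult.assoc\<close>)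
      moreover have "?d \<le> 2 * e"
        using True c j unfolding \<theta> \<theta>' by (auto simp: e_def intro!: softmax_lipschitz Max_ge)
      ultimately show False by simp
    next
      case False
      have "{l. l < n \<and> (\<forall>i<n. \<not> ln (p i) - ln (p l) < q (i, l))} = {l. l < n \<and> (\<forall>i<n. \<not> ln (p i) - ln (p l) < q' (i, l))}"
        using q by auto
      then have "?d = 0" using False c by (simp add: \<theta> \<theta>')
      then show False using less[of "\<lambda>(c, y, \<sigma>, q) p. of_bool c"] by (simp add: share_features_def)
    qed
  qed
qed

text \<open>The bracket adds the bounds of the flag, of \<open>n\<close> entries of
  \<open>y\<close>, of \<open>n\<close> terms \<open>\<sigma> * ln (p l)\<close> and of
  \<open>n\<^sup>2\<close> comparisons. The outer \<open>n\<close> accounts for the \<open>n\<close>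
  shares per price.\<close>

definition share_complexity :: "real \<Rightarrow> real \<Rightarrow> real \<Rightarrow> real \<Rightarrow> real" where
  "share_complexity n D\<sigma> Dy Dp = n * (1 + n * (4 * (Dy + 1)) + n * (4 * (D\<sigma> + 2) * Dp) + n\<^sup>2)"

lemma param_share_rademacher:
  fixes Dy D\<sigma> Dp :: real
  assumes T: "T \<noteq> {}" and n: "1 \<le> n"
    and y: "\<And>c y \<sigma> q l. (c, y, \<sigma>, q) \<in> T \<Longrightarrow> l < n \<Longrightarrow> \<bar>y l\<bar> \<le> Dy + 1"
    and \<sigma>: "\<And>c y \<sigma> q l. (c, y, \<sigma>, q) \<in> T \<Longrightarrow> \<bar>\<sigma>\<bar> \<le> D\<sigma> + 2"
    and Dp: "0 \<le> Dp" "\<And>p. p \<in> set pts \<Longrightarrow> log_norm n p \<le> Dp"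
  shows "rademacher_sup T (concat (map (\<lambda>p. map (\<lambda>j \<theta>. param_share n tb \<theta> p j) [0..<n]) pts)) (\<lambda>_. 0)
    \<le> share_complexity n D\<sigma> Dy Dp * sqrt (length pts)"
proof -
  \<comment> \<open>Each pair of a price and a good has its own sign, although the features depend
    on the price only.\<close>
  define ks where "ks = List.product pts [0..<n]"
  have ks: "length ks = length pts * n" by (simp add: ks_def)
  have ks_mem: "fst k \<in> set pts" "snd k < n" if "k \<in> set ks" for k using that by (auto simp: ks_def)
  let ?N = "sqrt (length ks)"
  let ?R = "\<lambda>F. rademacher_sup T (map (\<lambda>k \<theta>. F \<theta> (fst k)) ks) (\<lambda>_. 0)"
  have lnp: "\<bar>ln (p l)\<bar> \<le> Dp" if "p \<in> set pts" "l < n" for p l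
  proof -
    have "\<bar>ln (p l)\<bar> \<le> L2_set (\<lambda>j. \<bar>ln (p j)\<bar>) {..<n}" using that by (intro member_le_L2_set) auto
    also have "\<dots> = log_norm n p" by (simp add: log_norm_def L2_set_def)
    finally show ?thesis using Dp(2)[OF that(1)] by simp
  qed
  have ysp: "\<bar>fst (snd \<theta>) l\<bar> \<le> Dy + 1" if "\<theta> \<in> T" "l < n" for \<theta> l
    using that y by (cases \<theta>) auto
  have \<sigma>sp: "\<bar>fst (snd (snd \<theta>))\<bar> \<le> D\<sigma> + 2" if "\<theta> \<in> T" for \<theta>
    using that \<sigma> by (cases \<theta>) auto
  have lin: "rademacher_sup T (map (\<lambda>k \<theta>. C \<theta> * X k) ks) (\<lambda>_. 0) \<le> B * b * ?N"
    if C: "\<And>\<theta>. \<theta> \<in> T \<Longrightarrow> \<bar>C \<theta>\<bar> \<le> B" and X: "\<And>k. k \<in> set ks \<Longrightarrow> \<bar>X k\<bar> \<le> b" and b: "0 \<le> b" for C X B b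
  proof -
    have B: "0 \<le> B" using C T by (meson abs_ge_zero ex_in_conv order_trans)
    have "rademacher_sup T (map (\<lambda>k \<theta>. C \<theta> * X k) ks) (\<lambda>_. 0)
        = rademacher_sup T (map (\<lambda>x \<theta>. C \<theta> * x) (map X ks)) (\<lambda>\<theta>. C \<theta> * 0)"
      by (simp add: comp_def)
    also have "\<dots> \<le> B * sqrt (0\<^sup>2 + (\<Sum>x\<leftarrow>map X ks. x\<^sup>2))"
      using T C by (rule rademacher_sup_linear)
    also have "\<dots> \<le> B * sqrt (b\<^sup>2 * length ks)"
    proof (intro mult_left_mono B real_sqrt_le_mono)
      have "(\<Sum>k\<leftarrow>ks. (X k)\<^sup>2) \<le> (\<Sum>k\<leftarrow>ks. b\<^sup>2)"
        using X b by (intro sum_list_mono) (auto simp: abs_le_square_iff[symmetric])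
      then show "0\<^sup>2 + (\<Sum>x\<leftarrow>map X ks. x\<^sup>2) \<le> b\<^sup>2 * length ks"
        by (simp add: comp_def sum_list_triv mult.commute)
    qed
    also have "\<dots> = B * b * ?N" using b by (simp add: real_sqrt_mult)
    finally show ?thesis .
  qed
  define w where "w = (D\<sigma> + 2) * Dp"
  have bnd: "bounded ((\<lambda>\<theta>. F \<theta> p) ` T)" if "F \<in> set (share_features n)" "p \<in> set pts" for F p
  proof -
    have "\<bar>F \<theta> p\<bar> \<le> 1 + 4 * (Dy + 1) + 4 * w" if "\<theta> \<in> T" for \<theta>
    proof -
      obtain c y' \<sigma>' q where \<theta>: "\<theta> = (c, y', \<sigma>', q)" by (cases \<theta>)
      have s: "\<bar>\<sigma>'\<bar> \<le> D\<sigma> + 2" "0 \<le> D\<sigma> + 2" using \<sigma>sp[OF that] by (auto simp: \<theta>)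
      have Y: "0 \<le> Dy + 1" using ysp[OF that, of 0] n by auto
      have yl: "\<bar>y' l\<bar> \<le> Dy + 1" if "l < n" for l using ysp[OF \<open>\<theta> \<in> T\<close> that] by (simp add: \<theta>)
      have sl: "\<bar>\<sigma>' * ln (p l)\<bar> \<le> w" if "l < n" for l
        unfolding abs_mult w_def using s lnp[OF \<open>p \<in> set pts\<close> that] by (intro mult_mono) auto
      have sD: "0 \<le> w" using s Dp by (simp add: w_def)
      consider "\<bar>F \<theta> p\<bar> \<le> 1" | l where "l < n" "F \<theta> p = 4 * y' l" | l where "l < n" "F \<theta> p = 4 * (\<sigma>' * ln (p l))"
        using \<open>F \<in> _\<close> by (auto simp: share_features_def \<theta>)
      then show ?thesis
      proof cases
        case 1
        have "(1::real) \<le> 1 + 4 * (Dy + 1) + 4 * w" using sD Y by simp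
        with 1 show ?thesis by (rule order_trans)
      next
        case (2 l)
        have "4 * \<bar>y' l\<bar> \<le> 1 + 4 * (Dy + 1) + 4 * w" using yl[OF 2(1)] sD by argo
        then show ?thesis by (simp add: 2(2) abs_mult)
      next
        case (3 l)
        have "4 * \<bar>\<sigma>' * ln (p l)\<bar> \<le> 1 + 4 * (Dy + 1) + 4 * w" using sl[OF 3(1)] Y by argo
        then show ?thesis by (simp add: 3(2) abs_mult)
      qed
    qed
    then show ?thesis by (auto intro!: boundedI)
  qed
  have "rademacher_sup T (concat (map (\<lambda>p. map (\<lambda>j \<theta>. param_share n tb \<theta> p j) [0..<n]) pts)) (\<lambda>_. 0)
      = rademacher_sup T (map (\<lambda>k \<theta>. param_share n tb \<theta> (fst k) (snd k)) ks) (\<lambda>_. 0)"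
    by (simp add: ks_def product_concat_map map_concat comp_def)
  also have "\<dots> \<le> rademacher_sup T (concat (map (\<lambda>k. map (\<lambda>F \<theta>. F \<theta> (fst k)) (share_features n)) ks)) (\<lambda>_. 0)"
  proof (rule rademacher_contraction[OF T])
    show "\<exists>v\<in>set (map (\<lambda>F \<theta>. F \<theta> (fst k)) (share_features n)).
        \<bar>param_share n tb t (fst k) (snd k) - param_share n tb t' (fst k) (snd k)\<bar> \<le> \<bar>v t - v t'\<bar>"
      if "k \<in> set ks" for k t t'
      using param_share_lipschitz[OF ks_mem(2)[OF that], of tb t "fst k" t'] by auto
    show "bounded ((\<lambda>\<theta>. param_share n tb \<theta> (fst k) (snd k)) ` T)" if "k \<in> set ks" for k
      using param_share_bounds[OF ks_mem(2)[OF that]] by (intro boundedI[where B=1]) auto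
    show "bounded (v ` T)" if "k \<in> set ks" "v \<in> set (map (\<lambda>F \<theta>. F \<theta> (fst k)) (share_features n))" for k v
      using that bnd ks_mem(1)[OF that(1)] by auto
  qed (auto intro: boundedI[where B=0])
  also have "\<dots> = rademacher_sup T (concat (map (\<lambda>F. map (\<lambda>k \<theta>. F \<theta> (fst k)) ks) (share_features n))) (\<lambda>_. 0)"
    by (rule rademacher_sup_concat_transpose)
  also have "\<dots> \<le> (\<Sum>F\<leftarrow>share_features n. ?R F)"
    using T by (intro rademacher_sup_concat) (auto intro!: bnd ks_mem)
  also have "\<dots> = ?R (\<lambda>(c, y, \<sigma>, q) p. of_bool c)
      + ((\<Sum>l\<leftarrow>[0..<n]. ?R (\<lambda>(c, y, \<sigma>, q) p. 4 * y l))
      + ((\<Sum>l\<leftarrow>[0..<n]. ?R (\<lambda>(c, y, \<sigma>, q) p. 4 * \<sigma> * ln (p l)))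
      + (\<Sum>(i, l)\<leftarrow>List.product [0..<n] [0..<n]. ?R (\<lambda>(c, y, \<sigma>, q) p. of_bool (ln (p i) - ln (p l) < q (i, l))))))"
    by (simp add: share_features_def comp_def case_prod_unfold)
  also have "\<dots> \<le> ?N + ((\<Sum>l\<leftarrow>[0..<n]. 4 * (Dy + 1) * ?N) + ((\<Sum>l\<leftarrow>[0..<n]. 4 * (D\<sigma> + 2) * Dp * ?N)
      + (\<Sum>(i, l)\<leftarrow>List.product [0..<n] [0..<n]. ?N)))"
  proof (intro add_mono sum_list_mono)
    show "?R (\<lambda>(c, y, \<sigma>, q) p. of_bool c) \<le> ?N"
      using lin[of "\<lambda>\<theta>. of_bool (fst \<theta>)" 1 "\<lambda>_. 1" 1] by (simp add: case_prod_unfold)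
    show "?R (\<lambda>(c, y, \<sigma>, q) p. 4 * y l) \<le> 4 * (Dy + 1) * ?N" if "l \<in> set [0..<n]" for l
    proof -
      have "\<bar>4 * fst (snd \<theta>) l\<bar> \<le> 4 * (Dy + 1)" if "\<theta> \<in> T" for \<theta>
        using ysp[OF that, of l] \<open>l \<in> _\<close> unfolding abs_mult by simp
      from lin[where X="\<lambda>_. 1" and b=1, OF this] show ?thesis by (simp add: case_prod_unfold)
    qed
    show "?R (\<lambda>(c, y, \<sigma>, q) p. 4 * \<sigma> * ln (p l)) \<le> 4 * (D\<sigma> + 2) * Dp * ?N" if "l \<in> set [0..<n]" for l
    proof -
      have "\<bar>4 * fst (snd (snd \<theta>))\<bar> \<le> 4 * (D\<sigma> + 2)" if "\<theta> \<in> T" for \<theta>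
        using \<sigma>sp[OF that] unfolding abs_mult by simp
      moreover have "\<bar>ln (fst k l)\<bar> \<le> Dp" if "k \<in> set ks" for k
        using lnp ks_mem(1)[OF that] \<open>l \<in> _\<close> by simp
      ultimately have "rademacher_sup T (map (\<lambda>k \<theta>. 4 * fst (snd (snd \<theta>)) * ln (fst k l)) ks) (\<lambda>_. 0) \<le> 4 * (D\<sigma> + 2) * Dp * ?N"
        using Dp(1) by (rule lin)
      then show ?thesis by (simp add: case_prod_unfold)
    qed
    \<comment> \<open>The points are the log price ratios of the sample and the matrix entry at
      \<open>il\<close> is the threshold, whose size does not enter the bound.\<close>
    show "(case il of (i, l) \<Rightarrow> ?R (\<lambda>(c, y, \<sigma>, q) p. of_bool (ln (p i) - ln (p l) < q (i, l)))) \<le> (case il of (i, l) \<Rightarrow> ?N)" for il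
      using rademacher_sup_threshold[OF T, of "\<lambda>\<theta>. snd (snd (snd \<theta>)) il" "map (\<lambda>k. ln (fst k (fst il)) - ln (fst k (snd il))) ks"]
      by (simp add: case_prod_unfold comp_def)
  qed
  also have "\<dots> = (1 + n * (4 * (Dy + 1)) + n * (4 * (D\<sigma> + 2) * Dp) + n\<^sup>2) * ?N"
    by (simp add: sum_list_triv case_prod_unfold power2_eq_square) (simp add: algebra_simps)
  also have "\<dots> \<le> (1 + n * (4 * (Dy + 1)) + n * (4 * (D\<sigma> + 2) * Dp) + n\<^sup>2) * (n * sqrt (length pts))"
  proof (rule mult_left_mono)
    \<comment> \<open>There are \<open>n\<close> signs per price; replacing \<open>sqrt n\<close> by
      \<open>n\<close> keeps the bound polynomial.\<close>
    have "sqrt n \<le> n" using n by (intro real_le_lsqrt) (auto simp: power2_eq_square)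
    then show "?N \<le> n * sqrt (length pts)" by (simp add: ks real_sqrt_mult mult.commute mult_right_mono)
    obtain \<theta> where "\<theta> \<in> T" using T by auto
    then have "0 \<le> Dy + 1" "0 \<le> D\<sigma> + 2" using ysp[of \<theta> 0] \<sigma>sp[of \<theta>] n by auto
    then show "0 \<le> 1 + n * (4 * (Dy + 1)) + n * (4 * (D\<sigma> + 2) * Dp) + n\<^sup>2" using Dp(1) by simp
  qed
  finally show ?thesis by (simp add: share_complexity_def mult_ac)
qed

subsection \<open>Approximation of mixtures\<close>

lemma share_class_bounds:
  assumes "\<gamma> \<in> share_class n tb Dy D\<sigma> f" "p \<in> pos_simplex n" "j < n"
  shows "\<gamma> p j \<in> {0..1}"
  using assms softmax_bounds[OF assms(3)]
  by (cases f) (auto simp: ces_share_def cobb_douglas_share_def leontief_share_def linear_share_def Let_def)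

text \<open>The ranges exceed \<open>\<bar>y l\<bar> \<le> Dy\<close> and
  \<open>-1 \<le> \<sigma> \<le> D\<sigma>\<close> to leave room for nearby rationals. Extensional
  functions on finite sets keep the grid countable.\<close>

definition param_grid :: "nat \<Rightarrow> real \<Rightarrow> real \<Rightarrow> share_param set" where
  "param_grid n Dy D\<sigma> = UNIV \<times> PiE {..<n} (\<lambda>_. \<rat> \<inter> {- (Dy + 1)..Dy + 1})
     \<times> (\<rat> \<inter> {- (D\<sigma> + 2)..D\<sigma> + 2}) \<times> PiE ({..<n} \<times> {..<n}) (\<lambda>_. \<rat>)"

lemma countable_param_grid: "countable (param_grid n Dy D\<sigma>)"
  unfolding param_grid_def by (intro countable_SIGMA countable_PiE) (auto intro: countable_rat countable_subset[OF Int_lower1])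

lemma ces_share_approx:
  assumes P: "finite P" "P \<subseteq> pos_simplex n" and \<epsilon>: "0 < \<epsilon>"
    and y: "L2_set y {..<n} \<le> Dy" and \<sigma>: "\<sigma> \<in> {-1..D\<sigma>}" and D\<sigma>: "0 \<le> D\<sigma>"
  shows "\<exists>\<theta>\<in>param_grid n Dy D\<sigma>. \<forall>p\<in>P. \<forall>j<n. \<bar>ces_share n y \<sigma> p j - param_share n tb \<theta> p j\<bar> \<le> \<epsilon>"
proof -
  define L where "L = (\<Sum>p\<in>P. \<Sum>l<n. \<bar>ln (p l)\<bar>)"
  have L0: "0 \<le> L" unfolding L_def by (intro sum_nonneg) auto
  have L: "\<bar>ln (p l)\<bar> \<le> L" if "p \<in> P" "l < n" for p l
  proof -
    have "\<bar>ln (p l)\<bar> \<le> (\<Sum>l<n. \<bar>ln (p l)\<bar>)" using that by (intro member_le_sum) auto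
    also have "\<dots> \<le> L" unfolding L_def using that P by (intro member_le_sum[where f="\<lambda>p. \<Sum>l<n. \<bar>ln (p l)\<bar>"]) (auto intro: sum_nonneg)
    finally show ?thesis .
  qed
  \<comment> \<open>The argument of \<open>softmax\<close> will move by at most
    \<open>\<eta> * (1 + L)\<close>, to be bounded by \<open>\<epsilon> / 2\<close> in view of the
    Lipschitz constant 2; \<open>\<eta> \<le> 1\<close> keeps the parameters in the grid.\<close>
  define \<eta> where "\<eta> = min 1 (\<epsilon> / (2 * (1 + L)))"
  have \<eta>: "0 < \<eta>" "\<eta> \<le> 1" using \<epsilon> L0 by (auto simp: \<eta>_def)
  have "\<eta> * (1 + L) \<le> \<epsilon> / (2 * (1 + L)) * (1 + L)" using L0 by (intro mult_right_mono) (auto simp: \<eta>_def)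
  also have "\<dots> = \<epsilon> / 2" using L0 by (simp add: field_simps)
  finally have \<eta>L: "\<eta> * (1 + L) \<le> \<epsilon> / 2" .
  have "\<exists>r\<in>\<rat>. y l < r \<and> r < y l + \<eta>" for l using \<eta>(1) by (intro Rats_dense_in_real) simp
  then obtain r where r: "r l \<in> \<rat>" "y l < r l" "r l < y l + \<eta>" for l by metis
  obtain \<rho> where \<rho>: "\<rho> \<in> \<rat>" "\<sigma> < \<rho>" "\<rho> < \<sigma> + \<eta>" using Rats_dense_in_real[of \<sigma> "\<sigma> + \<eta>"] \<eta>(1) by auto
  have yb: "\<bar>y l\<bar> \<le> Dy" if "l < n" for l
  proof -
    have "\<bar>y l\<bar> \<le> L2_set (\<lambda>l. \<bar>y l\<bar>) {..<n}" using that by (intro member_le_L2_set) auto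
    also have "\<dots> = L2_set y {..<n}" by (simp add: L2_set_def)
    finally show ?thesis using y by simp
  qed
  have rb: "r l \<in> {- (Dy + 1)..Dy + 1}" if "l < n" for l
    using yb[OF that] r(2,3)[of l] \<eta>(2) unfolding abs_le_iff atLeastAtMost_iff by argo
  have \<rho>b: "\<rho> \<in> {- (D\<sigma> + 2)..D\<sigma> + 2}"
    using \<sigma> \<rho> \<eta>(2) D\<sigma> unfolding atLeastAtMost_iff by argo
  let ?\<theta> = "(True, restrict r {..<n}, \<rho>, \<lambda>_\<in>{..<n} \<times> {..<n}. 0) :: share_param"
  have "?\<theta> \<in> param_grid n Dy D\<sigma>"
    using r(1) rb \<rho>(1) \<rho>b unfolding param_grid_def by (auto simp: restrict_PiE_iff)
  moreover have "\<bar>ces_share n y \<sigma> p j - param_share n tb ?\<theta> p j\<bar> \<le> \<epsilon>" if p: "p \<in> P" and j: "j < n" for p j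
  proof -
    have "\<bar>(y l - \<sigma> * ln (p l)) - (restrict r {..<n} l - \<rho> * ln (p l))\<bar> \<le> \<epsilon> / 2" if l: "l < n" for l
    proof -
      have "\<bar>(y l - \<sigma> * ln (p l)) - (restrict r {..<n} l - \<rho> * ln (p l))\<bar> = \<bar>(y l - r l) + (\<rho> - \<sigma>) * ln (p l)\<bar>"
        using l by (simp add: algebra_simps)
      also have "\<dots> \<le> \<bar>y l - r l\<bar> + \<bar>\<rho> - \<sigma>\<bar> * \<bar>ln (p l)\<bar>" by (metis abs_mult abs_triangle_ineq)
      also have "\<dots> \<le> \<eta> + \<eta> * L"
        using r(2,3)[of l] \<rho>(2,3) L[OF p l] \<eta>(1) by (intro add_mono mult_mono) auto
      also have "\<dots> \<le> \<epsilon> / 2" using \<eta>L by (simp add: algebra_simps)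
      finally show ?thesis .
    qed
    then have "\<bar>softmax n (\<lambda>l. y l - \<sigma> * ln (p l)) j - softmax n (\<lambda>l. restrict r {..<n} l - \<rho> * ln (p l)) j\<bar> \<le> 2 * (\<epsilon> / 2)"
      using j by (intro softmax_lipschitz)
    then show ?thesis using p P(2) by (auto simp: ces_share_def)
  qed
  ultimately show ?thesis by blast
qed

text \<open>Shares jump, so the agreement on \<open>P\<close> has to be exact: finitely many log
  ratios leave a gap below \<open>y i - y l\<close>, and a rational in it gives the same
  comparisons. As these are strict, ties stay on the correct side.\<close>

lemma linear_share_approx:
  assumes P: "finite P" "P \<subseteq> pos_simplex n" and D: "0 \<le> Dy" "0 \<le> D\<sigma>"
  shows "\<exists>\<theta>\<in>param_grid n Dy D\<sigma>. \<forall>p\<in>P. \<forall>j<n. linear_share n tb y p j = param_share n tb \<theta> p j"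
proof -
  have "\<exists>r\<in>\<rat>. \<forall>p\<in>P. ln (p i) - ln (p l) < r \<longleftrightarrow> ln (p i) - ln (p l) < y i - y l" for i l
  proof -
    \<comment> \<open>The inserted element keeps the maximum defined when no log ratio lies below
      \<open>y i - y l\<close>.\<close>
    define B where "B = insert (y i - y l - 1) {t \<in> (\<lambda>p. ln (p i) - ln (p l)) ` P. t < y i - y l}"
    have B: "finite B" "B \<noteq> {}" using P by (auto simp: B_def)
    have "Max B < y i - y l" using Max_in[OF B] by (auto simp: B_def)
    then obtain r where r: "r \<in> \<rat>" "Max B < r" "r < y i - y l" using Rats_dense_in_real by blast
    have "ln (p i) - ln (p l) < r" if "p \<in> P" "ln (p i) - ln (p l) < y i - y l" for p
      using that r(2) Max_ge[OF B(1), of "ln (p i) - ln (p l)"] by (auto simp: B_def)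
    then show ?thesis using r by (intro bexI[of _ r]) auto
  qed
  then obtain r where r: "r i l \<in> \<rat>" "\<And>p. p \<in> P \<Longrightarrow> ln (p i) - ln (p l) < r i l \<longleftrightarrow> ln (p i) - ln (p l) < y i - y l" for i l
    by metis
  let ?\<theta> = "(False, \<lambda>_\<in>{..<n}. 0, 0, \<lambda>(i, l)\<in>{..<n} \<times> {..<n}. r i l) :: share_param"
  have "?\<theta> \<in> param_grid n Dy D\<sigma>"
    using r(1) D unfolding param_grid_def by (auto simp: restrict_PiE_iff)
  moreover have "linear_share n tb y p j = param_share n tb ?\<theta> p j" if p: "p \<in> P" and j: "j < n" for p j
  proof -
    have "{j. is_arg_max (\<lambda>i. y i - ln (p i)) (\<lambda>i. i < n) j}
        = {l. l < n \<and> (\<forall>i<n. \<not> ln (p i) - ln (p l) < (\<lambda>(i, l)\<in>{..<n} \<times> {..<n}. r i l) (i, l))}"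
      using r(2)[OF p] by (auto simp: is_arg_max_def algebra_simps)
    then show ?thesis using p P(2) j by (auto simp: linear_share_def Let_def)
  qed
  ultimately show ?thesis by blast
qed

lemma share_class_approx:
  assumes P: "finite P" "P \<subseteq> pos_simplex n" and \<epsilon>: "0 < \<epsilon>" and D: "0 \<le> Dy" "0 \<le> D\<sigma>"
    and \<gamma>: "\<gamma> \<in> share_class n tb Dy D\<sigma> f"
  shows "\<exists>\<theta>\<in>param_grid n Dy D\<sigma>. \<forall>p\<in>P. \<forall>j<n. \<bar>\<gamma> p j - param_share n tb \<theta> p j\<bar> \<le> \<epsilon>"
proof -
  consider y \<sigma> where "L2_set y {..<n} \<le> Dy" "\<sigma> \<in> {-1..D\<sigma>}" "\<gamma> = ces_share n y \<sigma>" | y where "\<gamma> = linear_share n tb y"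
  proof (cases f)
    case Cobb_Douglas
    then obtain y where y: "L2_set y {..<n} \<le> Dy" "\<gamma> = cobb_douglas_share n y" using \<gamma> by auto
    moreover have "cobb_douglas_share n y = ces_share n y 0" by (simp add: cobb_douglas_share_def ces_share_def)
    ultimately show thesis using that(1)[of y 0] D by simp
  next
    case Leontief
    then obtain y where y: "L2_set y {..<n} \<le> Dy" "\<gamma> = leontief_share n y" using \<gamma> by auto
    moreover have "leontief_share n y = ces_share n y (-1)" by (simp add: leontief_share_def ces_share_def)
    ultimately show thesis using that(1)[of y "-1"] D by simp
  qed (use \<gamma> that in auto)
  then show ?thesis
  proof cases
    case 1
    then show ?thesis using ces_share_approx[OF P \<epsilon>] D by blast
  next
    case 2
    obtain \<theta> where "\<theta> \<in> param_grid n Dy D\<sigma>" "\<forall>p\<in>P. \<forall>j<n. linear_share n tb y p j = param_share n tb \<theta> p j"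
      using linear_share_approx[OF P D] by blast
    then show ?thesis using 2 \<epsilon> by (intro bexI[of _ \<theta>]) auto
  qed
qed

(* Greedy form of Maurey's lemma: since the mean of g - h vanishes, some member has a nonpositive inner product with
   the error accumulated so far, so the squared norm of the error grows at most linearly. *)
lemma (in prob_space) mean_approx_by_list:
  fixes f :: "'d \<Rightarrow> 'a \<Rightarrow> real"
  assumes D: "finite D" and f: "\<And>d. d \<in> D \<Longrightarrow> f d \<in> borel_measurable M"
    and f01: "\<And>d x. d \<in> D \<Longrightarrow> x \<in> space M \<Longrightarrow> f d x \<in> {0..1}" and \<epsilon>: "0 < \<epsilon>"
  shows "\<exists>xs. xs \<noteq> [] \<and> set xs \<subseteq> space M \<and> (\<forall>d\<in>D. \<bar>expectation (f d) - list_avg (f d) xs\<bar> \<le> \<epsilon>)"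
proof -
  have int: "integrable M (f d)" if "d \<in> D" for d
    using f01[OF that] f[OF that] by (intro integrable_const_bound[where B=1]) auto
  have mean: "expectation (f d) \<in> {0..1}" if "d \<in> D" for d
    using f01[OF that] int[OF that] by (auto intro!: integral_ge_const integral_le_const)
  define e where "e d x = f d x - expectation (f d)" for d x
  have e2: "(e d x)\<^sup>2 \<le> 1" if "d \<in> D" "x \<in> space M" for d x
    using mean[OF that(1)] f01[OF that] by (auto simp: e_def abs_square_le_1)
  have "\<exists>xs. length xs = N \<and> set xs \<subseteq> space M \<and> (\<Sum>d\<in>D. (\<Sum>x\<leftarrow>xs. e d x)\<^sup>2) \<le> real (card D) * N" for N
  proof (induction N)
    case 0
    show ?case by simp
  next
    case (Suc N)
    then obtain xs where xs: "length xs = N" "set xs \<subseteq> space M" "(\<Sum>d\<in>D. (\<Sum>x\<leftarrow>xs. e d x)\<^sup>2) \<le> real (card D) * N" by blast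
    define s where "s d = (\<Sum>x\<leftarrow>xs. e d x)" for d
    have "\<exists>x\<in>space M. (\<Sum>d\<in>D. s d * e d x) \<le> 0"
    proof (rule ccontr)
      assume "\<not> ?thesis"
      then have pos: "0 < (\<Sum>d\<in>D. s d * e d x)" if "x \<in> space M" for x using that by force
      have "integrable M (\<lambda>x. \<Sum>d\<in>D. s d * e d x)"
        unfolding e_def using int by auto
      then have "0 < expectation (\<lambda>x. \<Sum>d\<in>D. s d * e d x)"
        using pos by (intro expectation_greater) auto
      moreover have "expectation (\<lambda>x. \<Sum>d\<in>D. s d * e d x) = (\<Sum>d\<in>D. s d * (expectation (f d) - expectation (f d)))"
        unfolding e_def using int by (subst Bochner_Integration.integral_sum) (auto simp: prob_space)
      ultimately show False by simp
    qed
    then obtain x where x: "x \<in> space M" "(\<Sum>d\<in>D. s d * e d x) \<le> 0" by blast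
    have "(\<Sum>d\<in>D. (\<Sum>x\<leftarrow>x # xs. e d x)\<^sup>2) = (\<Sum>d\<in>D. (s d)\<^sup>2 + 2 * (s d * e d x) + (e d x)\<^sup>2)"
      by (intro sum.cong) (auto simp: s_def power2_sum algebra_simps)
    also have "\<dots> = (\<Sum>d\<in>D. (s d)\<^sup>2) + 2 * (\<Sum>d\<in>D. s d * e d x) + (\<Sum>d\<in>D. (e d x)\<^sup>2)"
      by (simp add: sum.distrib sum_distrib_left)
    also have "\<dots> \<le> real (card D) * N + 2 * 0 + (\<Sum>d\<in>D. 1)"
      using xs(3) x e2 by (intro add_mono mult_left_mono sum_mono) (auto simp: s_def)
    also have "\<dots> = real (card D) * Suc N" by (simp add: algebra_simps)
    finally show ?case using xs x(1) by (intro exI[of _ "x # xs"]) auto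
  qed
  \<comment> \<open>Then \<open>card D * N \<le> (N * \<epsilon>)\<^sup>2\<close>, so linear growth
    of the squared error leaves an error of at most \<open>\<epsilon>\<close> in the
    average.\<close>
  moreover obtain N :: nat where N: "card D / \<epsilon>\<^sup>2 < N" using reals_Archimedean2 by blast
  ultimately obtain xs where xs: "length xs = N" "set xs \<subseteq> space M" "(\<Sum>d\<in>D. (\<Sum>x\<leftarrow>xs. e d x)\<^sup>2) \<le> real (card D) * N" by blast
  have N0: "0 < real N" by (rule le_less_trans[OF _ N]) simp
  have "\<bar>expectation (f d) - list_avg (f d) xs\<bar> \<le> \<epsilon>" if d: "d \<in> D" for d
  proof -
    have eq: "(\<Sum>x\<leftarrow>xs. e d x) = N * (list_avg (f d) xs - expectation (f d))"
      using N0 xs(1) by (simp add: e_def sum_list_subtractf sum_list_triv list_avg_def right_diff_distrib)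
    have "(\<Sum>x\<leftarrow>xs. e d x)\<^sup>2 \<le> (\<Sum>d\<in>D. (\<Sum>x\<leftarrow>xs. e d x)\<^sup>2)"
      using D d by (intro member_le_sum[where f="\<lambda>d. (\<Sum>x\<leftarrow>xs. e d x)\<^sup>2"]) auto
    also note xs(3)
    also have "real (card D) * N \<le> \<epsilon>\<^sup>2 * N * N"
      using N \<epsilon> N0 by (intro mult_right_mono) (auto simp: divide_less_eq mult.commute)
    finally have "(N * (list_avg (f d) xs - expectation (f d)))\<^sup>2 \<le> (N * \<epsilon>)\<^sup>2"
      unfolding eq by (simp add: power2_eq_square mult_ac)
    then have "\<bar>N * (list_avg (f d) xs - expectation (f d))\<bar> \<le> N * \<epsilon>"
      using \<epsilon> N0 by (subst (asm) abs_le_square_iff[symmetric]) auto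
    then show ?thesis using N0 by (simp add: abs_mult abs_minus_commute)
  qed
  then show ?thesis using xs N0 by (intro exI[of _ xs]) auto
qed

text \<open>Half of \<open>\<epsilon>\<close> pays for replacing \<open>\<omega>\<close> by a finite
  list of shares, half for replacing these by shares with grid parameters. Since \<open>P\<close> is
  finite, \<open>\<omega>\<close> enters through finitely many evaluations.\<close>

lemma conv_shares_approx:
  assumes H: "H = (\<Union>f<F. share_class n tb Dy D\<sigma> (kind f))" and h: "h \<in> conv_shares n H"
    and P: "finite P" "P \<subseteq> pos_simplex n" and \<epsilon>: "0 < \<epsilon>" and D: "0 \<le> Dy" "0 \<le> D\<sigma>"
  shows "\<exists>\<theta>s. \<theta>s \<noteq> [] \<and> set \<theta>s \<subseteq> param_grid n Dy D\<sigma> \<and>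
    (\<forall>p\<in>P. \<forall>j<n. \<bar>h p j - list_avg (\<lambda>\<theta>. param_share n tb \<theta> p j) \<theta>s\<bar> \<le> \<epsilon>)"
proof -
  obtain \<omega> where \<omega>: "prob_space \<omega>" "space \<omega> = H" "\<And>p. p \<in> pos_simplex n \<Longrightarrow> (\<lambda>\<gamma>. \<gamma> p) \<in> \<omega> \<rightarrow>\<^sub>M PiM {..<n} (\<lambda>_. borel)"
    "\<And>p. p \<in> pos_simplex n \<Longrightarrow> h p = (\<lambda>j\<in>{..<n}. \<integral>\<gamma>. \<gamma> p j \<partial>\<omega>)"
    using h unfolding conv_shares_def by blast
  interpret prob_space \<omega> by fact
  have "\<exists>\<gamma>s. \<gamma>s \<noteq> [] \<and> set \<gamma>s \<subseteq> space \<omega> \<and>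
      (\<forall>d\<in>P \<times> {..<n}. \<bar>expectation (\<lambda>\<gamma>. \<gamma> (fst d) (snd d)) - list_avg (\<lambda>\<gamma>. \<gamma> (fst d) (snd d)) \<gamma>s\<bar> \<le> \<epsilon> / 2)"
  proof (rule mean_approx_by_list)
    show "(\<lambda>\<gamma>. \<gamma> (fst d) (snd d)) \<in> borel_measurable \<omega>" if "d \<in> P \<times> {..<n}" for d
      using that P(2) by (intro measurable_compose[OF \<omega>(3) measurable_component_singleton]) auto
    show "\<gamma> (fst d) (snd d) \<in> {0..1}" if d: "d \<in> P \<times> {..<n}" and \<gamma>: "\<gamma> \<in> space \<omega>" for d \<gamma>
    proof -
      obtain f where "\<gamma> \<in> share_class n tb Dy D\<sigma> (kind f)" using \<gamma> \<omega>(2) H by auto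
      then show ?thesis using d P(2) by (intro share_class_bounds) auto
    qed
  qed (use P \<epsilon> in auto)
  then obtain \<gamma>s where \<gamma>s: "\<gamma>s \<noteq> []" "set \<gamma>s \<subseteq> H"
    "\<And>p j. p \<in> P \<Longrightarrow> j < n \<Longrightarrow> \<bar>h p j - list_avg (\<lambda>\<gamma>. \<gamma> p j) \<gamma>s\<bar> \<le> \<epsilon> / 2"
    using \<omega>(2,4) P(2) by fastforce
  have "\<exists>\<theta>\<in>param_grid n Dy D\<sigma>. \<forall>p\<in>P. \<forall>j<n. \<bar>\<gamma> p j - param_share n tb \<theta> p j\<bar> \<le> \<epsilon> / 2" if \<gamma>: "\<gamma> \<in> H" for \<gamma>
  proof -
    obtain f where "\<gamma> \<in> share_class n tb Dy D\<sigma> (kind f)" using \<gamma> H by auto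
    then show ?thesis using \<epsilon> by (intro share_class_approx[OF P _ D]) simp
  qed
  then obtain \<Theta> where \<Theta>: "\<And>\<gamma>. \<gamma> \<in> H \<Longrightarrow> \<Theta> \<gamma> \<in> param_grid n Dy D\<sigma>"
    "\<And>\<gamma> p j. \<gamma> \<in> H \<Longrightarrow> p \<in> P \<Longrightarrow> j < n \<Longrightarrow> \<bar>\<gamma> p j - param_share n tb (\<Theta> \<gamma>) p j\<bar> \<le> \<epsilon> / 2"
    by metis
  have "\<bar>h p j - list_avg (\<lambda>\<theta>. param_share n tb \<theta> p j) (map \<Theta> \<gamma>s)\<bar> \<le> \<epsilon>" if p: "p \<in> P" and j: "j < n" for p j
  proof -
    have "list_avg (\<lambda>\<theta>. param_share n tb \<theta> p j) (map \<Theta> \<gamma>s) = list_avg (\<lambda>\<gamma>. param_share n tb (\<Theta> \<gamma>) p j) \<gamma>s"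
      by (simp add: list_avg_def comp_def)
    moreover have "\<bar>list_avg (\<lambda>\<gamma>. \<gamma> p j - param_share n tb (\<Theta> \<gamma>) p j) \<gamma>s\<bar> \<le> \<epsilon> / 2"
    proof (rule abs_leI)
      have *: "\<gamma> p j - param_share n tb (\<Theta> \<gamma>) p j \<le> \<epsilon> / 2" "- (\<epsilon> / 2) \<le> \<gamma> p j - param_share n tb (\<Theta> \<gamma>) p j" if "\<gamma> \<in> set \<gamma>s" for \<gamma>
      proof -
        have "\<gamma> \<in> H" using that \<gamma>s(2) by blast
        from \<Theta>(2)[OF this p j]
        show "\<gamma> p j - param_share n tb (\<Theta> \<gamma>) p j \<le> \<epsilon> / 2" "- (\<epsilon> / 2) \<le> \<gamma> p j - param_share n tb (\<Theta> \<gamma>) p j"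
          unfolding abs_le_iff by argo+
      qed
      show "list_avg (\<lambda>\<gamma>. \<gamma> p j - param_share n tb (\<Theta> \<gamma>) p j) \<gamma>s \<le> \<epsilon> / 2"
        using * by (intro list_avg_le \<gamma>s(1))
      have "- (\<epsilon> / 2) \<le> list_avg (\<lambda>\<gamma>. \<gamma> p j - param_share n tb (\<Theta> \<gamma>) p j) \<gamma>s"
        using * by (intro list_avg_ge \<gamma>s(1))
      then show "- list_avg (\<lambda>\<gamma>. \<gamma> p j - param_share n tb (\<Theta> \<gamma>) p j) \<gamma>s \<le> \<epsilon> / 2" by simp
    qed
    ultimately show ?thesis using \<gamma>s(3)[OF p j] unfolding list_avg_diff by simp argo
  qed
  then show ?thesis using \<gamma>s \<Theta>(1) by (intro exI[of _ "map \<Theta> \<gamma>s"]) auto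
qed

section \<open>Measurability of the parametrized shares in the price\<close>

lemma ln_component_measurable:
  assumes "sets \<tau> = sets (price_space n)" "l < n"
  shows "(\<lambda>p. ln (p l)) \<in> borel_measurable \<tau>"
proof -
  have "(\<lambda>p. p l) \<in> borel_measurable (price_space n)"
    unfolding price_space_def using assms(2) by (intro measurable_restrict_space1 measurable_component_singleton) auto
  then have "(\<lambda>p. p l) \<in> borel_measurable \<tau>" using measurable_cong_sets[OF assms(1) refl] by blast
  then show ?thesis by (intro borel_measurable_ln)
qed

lemma param_share_measurable:
  assumes \<tau>: "sets \<tau> = sets (price_space n)" and j: "j < n"
  shows "(\<lambda>p. param_share n tb \<theta> p j) \<in> borel_measurable \<tau>"
proof -
  obtain c y \<sigma> q where \<theta>: "\<theta> = (c, y, \<sigma>, q)" by (cases \<theta>)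
  show ?thesis
  proof (cases c)
    case True
    have "(\<lambda>p. exp (y j - \<sigma> * ln (p j)) / (\<Sum>i<n. exp (y i - \<sigma> * ln (p i)))) \<in> borel_measurable \<tau>"
      using j
      by (intro borel_measurable_divide borel_measurable_sum borel_measurable_exp[THEN measurable_compose[rotated]]
          borel_measurable_diff borel_measurable_times borel_measurable_const ln_component_measurable[OF \<tau>]) auto
    then show ?thesis using True j by (simp add: \<theta> softmax_def)
  next
    case False
    define C where "C p l \<longleftrightarrow> (\<forall>i\<in>{..<n}. \<not> ln (p i) - ln (p l) < q (i, l))" for p l
    define A where "A p = {l. l < n \<and> C p l}" for p
    \<comment> \<open>\<open>tb\<close> is arbitrary, so measurability passes through the candidate
      set, which takes finitely many values; each fibre is a finite Boolean combination of
      comparisons.\<close>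
    have "A \<in> \<tau> \<rightarrow>\<^sub>M count_space (Pow {..<n})"
    proof (subst measurable_count_space_eq2, simp, intro conjI ballI)
      show "A \<in> space \<tau> \<rightarrow> Pow {..<n}" by (auto simp: A_def)
      fix S assume "S \<in> Pow {..<n}"
      then have S: "\<forall>l. l \<in> S \<longrightarrow> l < n" by auto
      have "A p = S \<longleftrightarrow> (\<forall>l. (l < n \<and> C p l) \<longleftrightarrow> l \<in> S)" for p
        by (simp only: A_def set_eq_iff mem_Collect_eq)
      then have "A p = S \<longleftrightarrow> (\<forall>l\<in>{..<n}. l \<in> S \<longleftrightarrow> C p l)" for p
        using S by (simp only: Ball_def lessThan_iff) blast
      then have "A -` {S} \<inter> space \<tau> = {p \<in> space \<tau>. \<forall>l\<in>{..<n}. l \<in> S \<longleftrightarrow> C p l}"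
        by (simp only: vimage_singleton_eq set_eq_iff Int_iff mem_Collect_eq) blast
      also have "\<dots> \<in> sets \<tau>"
      proof (rule sets.sets_Collect_finite_All')
        fix l assume "l \<in> {..<n}"
        then have less: "{p \<in> space \<tau>. ln (p i) - ln (p l) < q (i, l)} \<in> sets \<tau>" if "i < n" for i
          using that ln_component_measurable[OF \<tau>] by (intro borel_measurable_less borel_measurable_diff) auto
        have "{p \<in> space \<tau>. C p l} \<in> sets \<tau>"
          unfolding C_def using j less by (intro sets.sets_Collect_finite_All' sets.sets_Collect_neg) auto
        then show "{p \<in> space \<tau>. l \<in> S \<longleftrightarrow> C p l} \<in> sets \<tau>"
          by (cases "l \<in> S") (simp_all only: simp_thms sets.sets_Collect_neg)
      qed (use j in auto)
      finally show "A -` {S} \<inter> space \<tau> \<in> sets \<tau>" .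
    qed
    then have "(\<lambda>p. of_bool (j = tb (A p)) :: real) \<in> borel_measurable \<tau>"
      by (rule measurable_compose) simp
    then show ?thesis using False by (simp add: \<theta> A_def C_def lessThan_def)
  qed
qed

subsection \<open>The generalization bound\<close>

lemma polynomial4_share_complexity: "polynomial4 share_complexity"
  unfolding polynomial4_def
proof (intro exI allI)
  fix n D\<sigma> Dy Dp :: real
  \<comment> \<open>Expanded: \<open>n + n ^ 3 + 4 * n\<^sup>2 + 4 * n\<^sup>2 * Dy + 4 * n\<^sup>2
    * D\<sigma> * Dp + 8 * n\<^sup>2 * Dp\<close>.\<close>
  show "share_complexity n D\<sigma> Dy Dp = (\<Sum>a\<le>3. \<Sum>b\<le>3. \<Sum>i\<le>3. \<Sum>j\<le>3.
      (\<lambda>a b i j. if (a, b, i, j) \<in> {(1, 0, 0, 0), (3, 0, 0, 0)} then 1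
      else if (a, b, i, j) \<in> {(2, 0, 0, 0), (2, 0, 1, 0), (2, 1, 0, 1)} then 4
      else if (a, b, i, j) = (2, 0, 0, 1) then 8 else 0) a b i j * n ^ a * D\<sigma> ^ b * Dy ^ i * Dp ^ j)"
    by (simp add: share_complexity_def numeral_3_eq_3 numeral_2_eq_2 algebra_simps)
qed

text \<open>The target \<open>g p\<close> is common to the mixtures compared, so it disappears in
  the contraction; hence the bound does not involve the market.\<close>

lemma mixture_loss_rademacher:
  fixes Dy D\<sigma> Dp :: real
  assumes T: "T \<noteq> {}" and n: "1 \<le> n"
    and y: "\<And>c y \<sigma> q l. (c, y, \<sigma>, q) \<in> T \<Longrightarrow> l < n \<Longrightarrow> \<bar>y l\<bar> \<le> Dy + 1"
    and \<sigma>: "\<And>c y \<sigma> q l. (c, y, \<sigma>, q) \<in> T \<Longrightarrow> \<bar>\<sigma>\<bar> \<le> D\<sigma> + 2"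
    and Dp: "0 \<le> Dp" "\<And>p. p \<in> set pts \<Longrightarrow> log_norm n p \<le> Dp"
    and g: "\<And>p j. p \<in> set pts \<Longrightarrow> j < n \<Longrightarrow> g p j \<in> {0..1}"
  shows "rademacher_sup {xs. xs \<noteq> [] \<and> set xs \<subseteq> T}
      (map (\<lambda>p xs. sup_loss n (\<lambda>j. list_avg (\<lambda>\<theta>. param_share n tb \<theta> p j) xs) (g p)) pts) (\<lambda>_. 0)
    \<le> share_complexity n D\<sigma> Dy Dp * sqrt (length pts)"
proof -
  let ?X = "{xs. xs \<noteq> [] \<and> set xs \<subseteq> T}"
  let ?m = "\<lambda>p j xs. list_avg (\<lambda>\<theta>. param_share n tb \<theta> p j) xs"
  obtain \<theta>\<^sub>0 where "\<theta>\<^sub>0 \<in> T" using T by auto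
  then have X: "?X \<noteq> {}" by (intro ex_in_conv[THEN iffD1] exI[of _ "[\<theta>\<^sub>0]"]) auto
  have m01: "?m p j xs \<in> {0..1}" if "xs \<in> ?X" "j < n" for p j xs
    using that param_share_bounds[OF that(2)] by (auto intro!: list_avg_le list_avg_ge)
  have "rademacher_sup ?X (map (\<lambda>p xs. sup_loss n (\<lambda>j. ?m p j xs) (g p)) pts) (\<lambda>_. 0)
      \<le> rademacher_sup ?X (concat (map (\<lambda>p. map (\<lambda>j xs. ?m p j xs) [0..<n]) pts)) (\<lambda>_. 0)"
  proof (rule rademacher_contraction[OF X])
    show "\<exists>v\<in>set (map (\<lambda>j xs. ?m p j xs) [0..<n]). \<bar>sup_loss n (\<lambda>j. ?m p j xs) (g p) - sup_loss n (\<lambda>j. ?m p j xs') (g p)\<bar> \<le> \<bar>v xs - v xs'\<bar>"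
      for p xs xs'
      using sup_loss_lipschitz[OF n, of "\<lambda>j. ?m p j xs" "g p" "\<lambda>j. ?m p j xs'"] by auto
    show "bounded ((\<lambda>xs. sup_loss n (\<lambda>j. ?m p j xs) (g p)) ` ?X)" if "p \<in> set pts" for p
    proof (rule boundedI[where B=1], clarify)
      fix xs assume "xs \<noteq> []" "set xs \<subseteq> T"
      then have "sup_loss n (\<lambda>j. ?m p j xs) (g p) \<in> {0..1}"
        using g[OF that] m01 by (intro sup_loss_bounds n) auto
      then show "norm (sup_loss n (\<lambda>j. ?m p j xs) (g p)) \<le> 1" by simp
    qed
    show "bounded (v ` ?X)" if v: "v \<in> set (map (\<lambda>j xs. ?m p j xs) [0..<n])" for p v
    proof (rule boundedI[where B=1])
      fix r assume "r \<in> v ` ?X"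
      then obtain xs j where "xs \<in> ?X" "j < n" "r = ?m p j xs" using v by auto
      then show "norm r \<le> 1" using m01[of xs j p] by simp
    qed
  qed (auto intro: boundedI[where B=0])
  also have "\<dots> = rademacher_sup ?X (map list_avg (concat (map (\<lambda>p. map (\<lambda>j \<theta>. param_share n tb \<theta> p j) [0..<n]) pts))) (list_avg (\<lambda>_. 0))"
    by (simp add: map_concat comp_def list_avg_def[of "\<lambda>_. 0", abs_def])
  also have "\<dots> \<le> rademacher_sup T (concat (map (\<lambda>p. map (\<lambda>j \<theta>. param_share n tb \<theta> p j) [0..<n]) pts)) (\<lambda>_. 0)"
  proof (rule rademacher_sup_mixture[OF T])
    fix a assume "a \<in> set (concat (map (\<lambda>p. map (\<lambda>j \<theta>. param_share n tb \<theta> p j) [0..<n]) pts))"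
    then obtain p j where a: "j < n" "a = (\<lambda>\<theta>. param_share n tb \<theta> p j)" by auto
    show "bounded (a ` T)"
      using param_share_bounds[OF a(1)] unfolding a(2) by (intro boundedI[where B=1]) auto
  qed (auto intro: boundedI[where B=0])
  also have "\<dots> \<le> share_complexity n D\<sigma> Dy Dp * sqrt (length pts)"
    by (rule param_share_rademacher[OF T n]) (use y \<sigma> Dp in blast)+
  finally show ?thesis .
qed

text \<open>The bound on log prices is given for the sample, whereas the ghost sample needs it under
  \<open>\<tau>\<close>; coordinate 0 exists because \<open>1 \<le> K\<close>.\<close>

lemma AE_iid_component:
  fixes K :: nat
  assumes \<tau>: "prob_space \<tau>" and K: "1 \<le> K" and P: "{x \<in> space \<tau>. P x} \<in> sets \<tau>"
    and AE: "AE ps in PiM {..<K} (\<lambda>_. \<tau>). \<forall>k<K. P (ps k)"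
  shows "AE x in \<tau>. P x"
proof -
  have "AE ps in PiM {..<K} (\<lambda>_. \<tau>). P (ps 0)" using AE by eventually_elim (use K in auto)
  then have "AE x in distr (PiM {..<K} (\<lambda>_. \<tau>)) \<tau> (\<lambda>ps. ps 0). P x"
    using K P by (subst AE_distr_iff) auto
  then show ?thesis using K \<tau> by (subst (asm) distr_PiM_component) auto
qed

lemma conv_shares_uniform_bound:
  fixes Dy D\<sigma> Dp \<delta> :: real
  assumes n: "1 \<le> n" and D: "0 \<le> Dy" "0 \<le> D\<sigma>" "0 \<le> Dp"
    and H: "H = (\<Union>f<F. share_class n tb Dy D\<sigma> (kind f))"
    and K: "1 \<le> K" and \<tau>: "prob_space \<tau>" "sets \<tau> = sets (price_space n)"
    and AE: "AE ps in PiM {..<K} (\<lambda>_. \<tau>). \<forall>k<K. log_norm n (ps k) \<le> Dp"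
    and g_meas: "g \<in> \<tau> \<rightarrow>\<^sub>M PiM {..<n} (\<lambda>_. borel)"
    and g01: "\<And>p j. p \<in> pos_simplex n \<Longrightarrow> j < n \<Longrightarrow> g p j \<in> {0..1}"
    and \<delta>: "0 < \<delta>" "\<delta> < 1"
  shows "\<exists>A\<in>sets (PiM {..<K} (\<lambda>_. \<tau>)). 1 - \<delta> \<le> measure (PiM {..<K} (\<lambda>_. \<tau>)) A \<and>
    (\<forall>ps\<in>A. \<forall>h\<in>conv_shares n H.
      (\<integral>p. sup_loss n (h p) (g p) \<partial>\<tau>) \<le> empirical_risk n K ps (\<lambda>k. g (ps k)) h
        + 2 * (share_complexity n D\<sigma> Dy Dp / sqrt K) + sqrt (ln (1 / \<delta>) / (2 * K)))"
proof -
  interpret \<tau>: prob_space \<tau> by fact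
  let ?PI = "PiM {..<K} (\<lambda>_. \<tau>)" and ?PJ = "PiM {K..<2 * K} (\<lambda>_. \<tau>)"
  interpret PJ: prob_space ?PJ by (intro prob_space_PiM \<tau>(1))
  define T where "T = param_grid n Dy D\<sigma>"
  define X where "X = {xs. xs \<noteq> [] \<and> set xs \<subseteq> T}"
  define a where "a xs p = sup_loss n (\<lambda>j. list_avg (\<lambda>\<theta>. param_share n tb \<theta> p j) xs) (g p)" for xs p
  define Q where "Q = share_complexity n D\<sigma> Dy Dp"
  have Q0: "0 \<le> Q" using D by (simp add: Q_def share_complexity_def)
  have sp: "space \<tau> = pos_simplex n"
  proof -
    have "space \<tau> = space (price_space n)" using \<tau>(2) by (rule sets_eq_imp_space_eq)
    also have "\<dots> = pos_simplex n"
      by (auto simp: price_space_def space_restrict_space space_PiM pos_simplex_def unit_simplex_def orthant_def PiE_iff extensional_def)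
    finally show ?thesis .
  qed
  have T0: "T \<noteq> {}"
    using linear_share_approx[of "{}" n Dy D\<sigma>] D by (auto simp: T_def)
  then obtain \<theta>\<^sub>0 where "\<theta>\<^sub>0 \<in> T" by auto
  then have X0: "X \<noteq> {}" unfolding X_def by (intro ex_in_conv[THEN iffD1] exI[of _ "[\<theta>\<^sub>0]"]) auto
  have X: "countable X"
    by (rule countable_subset[of _ "lists T"]) (auto simp: X_def T_def intro: countable_lists countable_param_grid)
  have g_comp: "(\<lambda>p. g p j) \<in> borel_measurable \<tau>" if "j < n" for j
    using that by (intro measurable_compose[OF g_meas measurable_component_singleton]) auto
  have a_meas: "a xs \<in> borel_measurable \<tau>" for xs
  proof -
    have "(\<lambda>p. \<Sum>\<theta>\<leftarrow>xs. param_share n tb \<theta> p j) \<in> borel_measurable \<tau>" if "j < n" for j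
      by (induction xs) (auto intro!: borel_measurable_add param_share_measurable \<tau>(2) that)
    then show ?thesis
      unfolding a_def[abs_def] sup_loss_def list_avg_def
      using g_comp by (intro borel_measurable_Max borel_measurable_abs borel_measurable_diff borel_measurable_divide) auto
  qed
  have a01: "a xs p \<in> {0..1}" if "xs \<in> X" "p \<in> space \<tau>" for xs p
    unfolding a_def
  proof (intro sup_loss_bounds n g01)
    show "list_avg (\<lambda>\<theta>. param_share n tb \<theta> p j) xs \<in> {0..1}" if "j < n" for j
      using param_share_bounds[OF that] \<open>xs \<in> X\<close> by (auto simp: X_def intro!: list_avg_le list_avg_ge)
  qed (use that sp in auto)
  define S where "S = {p. log_norm n p \<le> Dp}"
  have S: "AE p in \<tau>. p \<in> S"
    unfolding S_def mem_Collect_eq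
  proof (rule AE_iid_component[OF \<tau>(1) K _ AE])
    have "(\<lambda>p. log_norm n p) \<in> borel_measurable \<tau>"
      unfolding log_norm_def L2_set_def
      using ln_component_measurable[OF \<tau>(2)]
      by (intro measurable_compose[OF _ borel_measurable_sqrt]
          borel_measurable_sum borel_measurable_power) auto
    then show "{p \<in> space \<tau>. log_norm n p \<le> Dp} \<in> sets \<tau>"
      by (intro borel_measurable_le) auto
  qed
  have R: "rademacher_sup X (map (\<lambda>k xs. a xs (ps k)) [0..<K]) (\<lambda>_. 0) \<le> Q * sqrt K"
    if ps: "\<And>k. k < K \<Longrightarrow> ps k \<in> space \<tau> \<inter> S" for ps
  proof -
    have "rademacher_sup X (map (\<lambda>k xs. a xs (ps k)) [0..<K]) (\<lambda>_. 0)
        = rademacher_sup X (map (\<lambda>p xs. a xs p) (map ps [0..<K])) (\<lambda>_. 0)"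
      by (simp add: comp_def)
    also have "\<dots> \<le> Q * sqrt (length (map ps [0..<K]))"
      unfolding X_def a_def Q_def
    proof (rule mixture_loss_rademacher[OF T0 n _ _ D(3)])
      show "\<bar>y l\<bar> \<le> Dy + 1" if "(c, y, \<sigma>, q) \<in> T" "l < n" for c y \<sigma> q l
      proof -
        have "y l \<in> {- (Dy + 1)..Dy + 1}" using that by (auto simp: T_def param_grid_def PiE_iff)
        then show ?thesis unfolding abs_le_iff atLeastAtMost_iff by argo
      qed
      show "\<bar>\<sigma>\<bar> \<le> D\<sigma> + 2" if "(c, y, \<sigma>, q) \<in> T" for c y \<sigma> q
      proof -
        have "\<sigma> \<in> {- (D\<sigma> + 2)..D\<sigma> + 2}" using that by (auto simp: T_def param_grid_def)
        then show ?thesis unfolding abs_le_iff atLeastAtMost_iff by argo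
      qed
    qed (use ps sp g01 in \<open>auto simp: S_def\<close>)
    finally show ?thesis by simp
  qed
  obtain A where A: "A \<in> sets ?PI" "1 - \<delta> \<le> measure ?PI A"
    "\<And>ps. ps \<in> A \<Longrightarrow> integrable ?PJ (\<lambda>qs. SUP xs\<in>X. \<Sum>k<K. a xs (qs (K + k)) - a xs (ps k))"
    "\<And>ps. ps \<in> A \<Longrightarrow> (\<integral>qs. (SUP xs\<in>X. \<Sum>k<K. a xs (qs (K + k)) - a xs (ps k)) \<partial>?PJ) \<le> 2 * (Q * sqrt K) + sqrt (K * ln (1 / \<delta>) / 2)"
    using uniform_deviation[OF \<tau>(1) X X0 K a_meas a01 S R \<delta>] by blast
  have "(\<integral>p. sup_loss n (h p) (g p) \<partial>\<tau>) \<le> empirical_risk n K ps (\<lambda>k. g (ps k)) h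
      + 2 * (Q / sqrt K) + sqrt (ln (1 / \<delta>) / (2 * K))" if ps: "ps \<in> A" and h: "h \<in> conv_shares n H" for ps h
  proof (cases "integrable \<tau> (\<lambda>p. sup_loss n (h p) (g p))")
    \<comment> \<open>Measurability of \<open>h\<close> in the price is not part of
      \<open>conv_shares\<close>. Without integrability the Bochner integral is 0 by convention, and
      the right side is nonnegative.\<close>
    case False
    have "0 \<le> sup_loss n x z" for x z
      using sup_loss_ge[of 0 n x z] n by (auto intro: order_trans[OF abs_ge_zero])
    then have "0 \<le> empirical_risk n K ps (\<lambda>k. g (ps k)) h"
      unfolding empirical_risk_def by (intro mult_nonneg_nonneg sum_nonneg) auto
    then show ?thesis using False Q0 \<delta> by (simp add: not_integrable_integral_eq)
  next
    case True
    define b where "b p = sup_loss n (h p) (g p)" for p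
    have b_int: "integrable \<tau> b" using True by (simp add: b_def[abs_def])
    have ps_sp: "ps k \<in> pos_simplex n" if "k < K" for k
      using sets.sets_into_space[OF A(1)] ps that sp by (auto simp: space_PiM)
    have comp: "integrable ?PJ (\<lambda>qs. b (qs (K + k)))" "(\<integral>qs. b (qs (K + k)) \<partial>?PJ) = (\<integral>p. b p \<partial>\<tau>)" if "k < K" for k
    proof -
      have d: "distr ?PJ \<tau> (\<lambda>qs. qs (K + k)) = \<tau>"
        using that \<tau>(1) by (intro distr_PiM_component) auto
      have m: "(\<lambda>qs. qs (K + k)) \<in> ?PJ \<rightarrow>\<^sub>M \<tau>" using that by (intro measurable_component_singleton) auto
      show "integrable ?PJ (\<lambda>qs. b (qs (K + k)))" using b_int by (intro integrable_distr[OF m]) (simp add: d)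
      show "(\<integral>qs. b (qs (K + k)) \<partial>?PJ) = (\<integral>p. b p \<partial>\<tau>)"
        using integral_distr[OF m, of b] b_int by (simp add: d)
    qed
    \<comment> \<open>The expected loss becomes a mean over the ghost sample, so the comparison with
      the countable class can be made for each \<open>qs\<close> separately.\<close>
    have "K * (\<integral>p. b p \<partial>\<tau>) - (\<Sum>k<K. b (ps k)) = (\<integral>qs. (\<Sum>k<K. b (qs (K + k)) - b (ps k)) \<partial>?PJ)"
      using comp by (subst Bochner_Integration.integral_sum) (auto simp: PJ.prob_space sum_subtractf)
    also have "\<dots> \<le> (\<integral>qs. (SUP xs\<in>X. \<Sum>k<K. a xs (qs (K + k)) - a xs (ps k)) \<partial>?PJ)"
    proof (rule Bochner_Integration.integral_mono)
      fix qs assume qs: "qs \<in> space ?PJ"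
      have qs_sp: "qs (K + k) \<in> pos_simplex n" if "k < K" for k
        using qs that sp by (auto simp: space_PiM PiE_iff)
      have "bdd_above ((\<lambda>xs. \<Sum>k<K. a xs (qs (K + k)) - a xs (ps k)) ` X)"
      proof (rule bdd_aboveI2)
        fix xs assume xs: "xs \<in> X"
        show "(\<Sum>k<K. a xs (qs (K + k)) - a xs (ps k)) \<le> (\<Sum>k<K. 1)"
        proof (rule sum_mono)
          fix k assume "k \<in> {..<K}"
          then have "a xs (qs (K + k)) \<in> {0..1}" "a xs (ps k) \<in> {0..1}"
            using a01[OF xs] qs_sp ps_sp sp by auto
          then show "a xs (qs (K + k)) - a xs (ps k) \<le> 1" by simp
        qed
      qed
      note upper = cSUP_upper[OF _ this]
      show "(\<Sum>k<K. b (qs (K + k)) - b (ps k)) \<le> (SUP xs\<in>X. \<Sum>k<K. a xs (qs (K + k)) - a xs (ps k))"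
      proof (rule field_le_epsilon)
        fix \<epsilon> :: real assume \<epsilon>: "0 < \<epsilon>"
        \<comment> \<open>The approximating list may depend on both samples; a tolerance of
          \<open>\<epsilon> / (2 * K)\<close> at each of the \<open>2 * K\<close> evaluations adds
          up to \<open>\<epsilon>\<close>.\<close>
        let ?P = "(\<lambda>k. qs (K + k)) ` {..<K} \<union> ps ` {..<K}"
        have P: "?P \<subseteq> pos_simplex n" using qs_sp ps_sp by auto
        have e: "0 < \<epsilon> / (2 * K)" using \<epsilon> K by simp
        obtain xs where xs: "xs \<noteq> []" "set xs \<subseteq> param_grid n Dy D\<sigma>"
          "\<forall>p\<in>?P. \<forall>j<n. \<bar>h p j - list_avg (\<lambda>\<theta>. param_share n tb \<theta> p j) xs\<bar> \<le> \<epsilon> / (2 * K)"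
          using conv_shares_approx[OF H h _ P e D(1,2)] by auto
        have "\<bar>b p - a xs p\<bar> \<le> \<epsilon> / (2 * K)" if p: "p \<in> ?P" for p
        proof -
          obtain j where "j < n" "\<bar>b p - a xs p\<bar> \<le> \<bar>h p j - list_avg (\<lambda>\<theta>. param_share n tb \<theta> p j) xs\<bar>"
            using sup_loss_lipschitz[OF n, of "h p" "g p" "\<lambda>j. list_avg (\<lambda>\<theta>. param_share n tb \<theta> p j) xs"]
            unfolding a_def b_def by auto
          moreover from xs(3) p \<open>j < n\<close> have "\<bar>h p j - list_avg (\<lambda>\<theta>. param_share n tb \<theta> p j) xs\<bar> \<le> \<epsilon> / (2 * K)"
            by blast
          ultimately show ?thesis by linarith
        qed
        then have ab: "\<bar>b (qs (K + k)) - a xs (qs (K + k))\<bar> \<le> \<epsilon> / (2 * K)" "\<bar>b (ps k) - a xs (ps k)\<bar> \<le> \<epsilon> / (2 * K)" if "k < K" for k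
          using that by auto
        have "(\<Sum>k<K. b (qs (K + k)) - b (ps k)) \<le> (\<Sum>k<K. (a xs (qs (K + k)) - a xs (ps k)) + \<epsilon> / K)"
        proof (rule sum_mono)
          fix k assume "k \<in> {..<K}"
          then have "b (qs (K + k)) - a xs (qs (K + k)) \<le> \<epsilon> / (2 * K)" "a xs (ps k) - b (ps k) \<le> \<epsilon> / (2 * K)"
            using ab[of k] by (auto simp: abs_le_iff)
          moreover have "\<epsilon> / (2 * K) + \<epsilon> / (2 * K) = \<epsilon> / K" by simp
          ultimately show "b (qs (K + k)) - b (ps k) \<le> (a xs (qs (K + k)) - a xs (ps k)) + \<epsilon> / K" by argo
        qed
        also have "\<dots> = (\<Sum>k<K. a xs (qs (K + k)) - a xs (ps k)) + \<epsilon>" using K by (simp add: sum.distrib)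
        also have "(\<Sum>k<K. a xs (qs (K + k)) - a xs (ps k)) \<le> (SUP xs\<in>X. \<Sum>k<K. a xs (qs (K + k)) - a xs (ps k))"
          using xs by (intro upper) (auto simp: X_def T_def)
        finally show "(\<Sum>k<K. b (qs (K + k)) - b (ps k)) \<le> (SUP xs\<in>X. \<Sum>k<K. a xs (qs (K + k)) - a xs (ps k)) + \<epsilon>" by simp
      qed
    qed (use comp A(3)[OF ps] in auto)
    also have "\<dots> \<le> 2 * (Q * sqrt K) + sqrt (K * ln (1 / \<delta>) / 2)" using A(4)[OF ps] .
    finally have main: "K * (\<integral>p. b p \<partial>\<tau>) \<le> (\<Sum>k<K. b (ps k)) + (2 * (Q * sqrt K) + sqrt (K * ln (1 / \<delta>) / 2))" by simp
    have K0: "0 < real K" using K by simp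
    have "(\<integral>p. b p \<partial>\<tau>) \<le> ((\<Sum>k<K. b (ps k)) + (2 * (Q * sqrt K) + sqrt (K * ln (1 / \<delta>) / 2))) / K"
      using main K0 by (simp add: pos_le_divide_eq mult.commute)
    also have "\<dots> = (\<Sum>k<K. b (ps k)) / K + 2 * (Q * (sqrt K / K)) + sqrt (K * ln (1 / \<delta>) / 2) / K"
      by (simp add: add_divide_distrib)
    also have "sqrt K / K = 1 / sqrt K" using K0 by (simp add: real_div_sqrt field_simps)
    also have "sqrt (K * ln (1 / \<delta>) / 2) / K = sqrt (ln (1 / \<delta>) / (2 * K))"
    proof -
      have "sqrt (K * ln (1 / \<delta>) / 2) / K = sqrt (K * ln (1 / \<delta>) / 2) / sqrt ((real K)\<^sup>2)" by simp
      also have "\<dots> = sqrt (ln (1 / \<delta>) / (2 * K))"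
        unfolding real_sqrt_divide[symmetric] using K0 by (simp add: power2_eq_square)
      finally show ?thesis .
    qed
    finally show ?thesis by (simp add: b_def empirical_risk_def)
  qed
  then show ?thesis using A(1,2) unfolding Q_def by blast
qed

theorem theorem5p1:
  shows "\<exists>Q :: real \<Rightarrow> real \<Rightarrow> real \<Rightarrow> real \<Rightarrow> real. polynomial4 Q \<and>
    (\<forall>(n::nat) (Dy::real) (D\<sigma>::real) (Dp::real) (F::nat) (kind :: nat \<Rightarrow> share_kind)
      (tb :: nat set \<Rightarrow> nat) (H :: ((nat \<Rightarrow> real) \<Rightarrow> nat \<Rightarrow> real) set).
      2 \<le> n \<and> 0 \<le> Dy \<and> 0 \<le> D\<sigma> \<and> 0 \<le> Dp \<and> 1 \<le> F \<and> tie_breaking n tb \<and>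
      H = (\<Union>f<F. share_class n tb Dy D\<sigma> (kind f)) \<longrightarrow>
      (\<forall>(K::nat) (\<tau> :: (nat \<Rightarrow> real) measure) (m::nat) u w x g (\<delta>::real).
        1 \<le> K \<and>
        prob_space \<tau> \<and> sets \<tau> = sets (price_space n) \<and>
        (AE ps in PiM {..<K} (\<lambda>_. \<tau>). \<forall>k<K. log_norm n (ps k) \<le> Dp) \<and>
        real_market n m u w x \<and> g = market_share n m x \<and>
        g \<in> \<tau> \<rightarrow>\<^sub>M PiM {..<n} (\<lambda>_. borel) \<and>
        0 < \<delta> \<and> \<delta> < 1 \<longrightarrow>
        (\<exists>A \<in> sets (PiM {..<K} (\<lambda>_. \<tau>)).
          1 - \<delta> \<le> measure (PiM {..<K} (\<lambda>_. \<tau>)) A \<and>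
          (\<forall>ps\<in>A. \<forall>h\<in>conv_shares n H.
            (\<integral>p. sup_loss n (h p) (g p) \<partial>\<tau>)
              \<le> empirical_risk n K ps (\<lambda>k. g (ps k)) h
                + 2 * sqrt 2 * (Q (real n) D\<sigma> Dy Dp / sqrt (real K) + sqrt (2 * ln (real F) / real K))
                + 6 * sqrt (ln (2 / \<delta>) / (2 * real K))))))"
proof (intro exI[of _ share_complexity] conjI polynomial4_share_complexity allI impI, elim conjE)
  fix n :: nat and Dy D\<sigma> Dp :: real and F :: nat and kind tb H
  fix K :: nat and \<tau> :: "(nat \<Rightarrow> real) measure" and m u w x g and \<delta> :: real
  assume n: "2 \<le> n" and D: "0 \<le> Dy" "0 \<le> D\<sigma>" "0 \<le> Dp" and F: "1 \<le> F"
    and H: "H = (\<Union>f<F. share_class n tb Dy D\<sigma> (kind f))" and K: "1 \<le> K"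
    and \<tau>: "prob_space \<tau>" "sets \<tau> = sets (price_space n)"
    and AE: "AE ps in PiM {..<K} (\<lambda>_. \<tau>). \<forall>k<K. log_norm n (ps k) \<le> Dp"
    and market: "real_market n m u w x" and g: "g = market_share n m x" "g \<in> \<tau> \<rightarrow>\<^sub>M PiM {..<n} (\<lambda>_. borel)"
    and \<delta>: "0 < \<delta>" "\<delta> < 1"
  let ?Q = "share_complexity (real n) D\<sigma> Dy Dp / sqrt (real K)"
  have Q0: "0 \<le> ?Q" using D by (simp add: share_complexity_def)
  \<comment> \<open>The factor 2 of symmetrization is enlarged to \<open>2 * sqrt 2\<close>, and
    \<open>ln F\<close> is nonnegative because \<open>1 \<le> F\<close>.\<close>
  have "2 * ?Q \<le> 2 * sqrt 2 * (?Q + sqrt (2 * ln (real F) / real K))"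
  proof -
    have "1 * ?Q \<le> sqrt 2 * (?Q + sqrt (2 * ln (real F) / real K))"
      using Q0 F by (intro mult_mono) auto
    then show ?thesis by simp
  qed
  moreover have "sqrt (ln (1 / \<delta>) / (2 * K)) \<le> 6 * sqrt (ln (2 / \<delta>) / (2 * K))"
  proof -
    have "1 * sqrt (ln (1 / \<delta>) / (2 * K)) \<le> 6 * sqrt (ln (2 / \<delta>) / (2 * K))"
      using \<delta> by (intro mult_mono real_sqrt_le_mono divide_right_mono) (auto simp: divide_right_mono)
    then show ?thesis by simp
  qed
  moreover note conv_shares_uniform_bound[OF _ D H K \<tau> AE g(2) _ \<delta>]
  ultimately show "\<exists>A \<in> sets (PiM {..<K} (\<lambda>_. \<tau>)).
          1 - \<delta> \<le> measure (PiM {..<K} (\<lambda>_. \<tau>)) A \<and>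
          (\<forall>ps\<in>A. \<forall>h\<in>conv_shares n H.
            (\<integral>p. sup_loss n (h p) (g p) \<partial>\<tau>)
              \<le> empirical_risk n K ps (\<lambda>k. g (ps k)) h
                + 2 * sqrt 2 * (share_complexity (real n) D\<sigma> Dy Dp / sqrt (real K) + sqrt (2 * ln (real F) / real K))
                + 6 * sqrt (ln (2 / \<delta>) / (2 * real K)))"
    using n market_share_bounds[OF market] unfolding g(1) by fastforce
qed

end
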